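(* Let $\Gamma$ be a finite group acting on $[n]=\{1,\ldots,n\}$, and let $G=\mathrm{Cay}(\Gamma,T)$ be a connected normal Cayley graph (i.e. $e\notin T$, $T=T^{-1}$, $T$ generates $\Gamma$ and is closed under conjugation). Let $m=\max_{\tau\in T}|\mathrm{supp}(\tau)|$, and suppose the action of $\Gamma$ on $[n]$ is $(m+a)$-transitive with $a\geq1$. For $k\geq0$ let $T_k=\{\tau\in T:\{1,\ldots,k\}\subseteq\mathrm{supp}(\tau)\}$ (so $T_0=T$) and $G_k=\mathrm{Cay}(\Gamma,T_k)$. Let $\Gamma^{(0)}=\Gamma$ and, for $1\leq i\leq a-1$, $\Gamma^{(i)}$ the pointwise stabilizer of $\{n-i+1,\ldots,n\}$; let $G_{k,i}=\mathrm{Cay}(\Gamma^{(i)},T_k\cap\Gamma^{(i)})$ and $B_\Pi^{(k,i)}=(b^{(k,i)}_{st})_{s,t\in[n-i]}$ with $b^{(k,i)}_{st}=|T_k\cap\Gamma^{(i)}\cap\Gamma_{t,s}|$; write $B_\Pi^{(k)}=B_\Pi^{(k,0)}$. If $\lambda_2(G_{k,a-1})=\lambda_2(B_\Pi^{(k,a-1)})$ for all $k\in\{0,1,\ldots,m-1\}$, then for $0\leq k\leq m-1$, $$\lambda_2(G_k)=\lambda_2(B_\Pi^{(k)})=|T_k\cap\Gamma_{k+1}|-|T_k\cap\Gamma_{k+2,k+1}|.$$ In particular $\lambda_2(G)=\lambda_2(B_\Pi^{(0)})=|T\cap\Gamma_1|-|T\cap\Gamma_{2,1}|$.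
   Context: Right action convention $x^{\gamma\delta}=(x^\gamma)^\delta$; $\Gamma_{j,i}=\{\gamma:j^\gamma=i\}$, $\Gamma_j=\Gamma_{j,j}$ the stabilizer of $j$; $\mathrm{supp}(\tau)$ is the set of points moved by $\tau$. $\mathrm{Cay}(\Delta,S)$ has vertex set $\Delta$ and edges $\{\delta,s\delta\}$. $s$-transitivity: any $s$-tuple of distinct points can be mapped to any other such tuple. $\lambda_2$ of a graph is the second largest adjacency eigenvalue, and of a symmetric matrix its second largest eigenvalue, counted with multiplicity. *)

theory Defs
  imports
    "HOL-Algebra.Group"
    "HOL-Algebra.Generated_Groups"
    "HOL-Algebra.Coset"
    "Jordan_Normal_Form.Char_Poly"
    "Graph_Theory.Pair_Digraph"
begin

(* HOL-Algebra's group_action is a left action; here x^(g h) = (x^g)^h, with act x g for x^g. *)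
locale right_action = group G for G (structure) +
  fixes E :: "'x set" and act :: "'x \<Rightarrow> 'a \<Rightarrow> 'x"
  assumes act_closed: "\<lbrakk>x \<in> E; g \<in> carrier G\<rbrakk> \<Longrightarrow> act x g \<in> E"
    and act_one: "x \<in> E \<Longrightarrow> act x \<one> = x"
    and act_mult: "\<lbrakk>x \<in> E; g \<in> carrier G; h \<in> carrier G\<rbrakk>
                     \<Longrightarrow> act x (g \<otimes> h) = act (act x g) h"

definition supp :: "'x set \<Rightarrow> ('x \<Rightarrow> 'g \<Rightarrow> 'x) \<Rightarrow> 'g \<Rightarrow> 'x set" where
  "supp E act g = {x \<in> E. act x g \<noteq> x}"

(* The set written with double index j,i: the group elements that map j to i. *)
definition transporter ::
  "('g, 'b) monoid_scheme \<Rightarrow> ('x \<Rightarrow> 'g \<Rightarrow> 'x) \<Rightarrow> 'x \<Rightarrow> 'x \<Rightarrow> 'g set" where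
  "transporter G act j i = {g \<in> carrier G. act j g = i}"

definition point_stabilizer ::
  "('g, 'b) monoid_scheme \<Rightarrow> ('x \<Rightarrow> 'g \<Rightarrow> 'x) \<Rightarrow> 'x \<Rightarrow> 'g set" where
  "point_stabilizer G act j = transporter G act j j"

definition pointwise_stabilizer ::
  "('g, 'b) monoid_scheme \<Rightarrow> ('x \<Rightarrow> 'g \<Rightarrow> 'x) \<Rightarrow> 'x set \<Rightarrow> 'g set" where
  "pointwise_stabilizer G act X = {g \<in> carrier G. \<forall>x\<in>X. act x g = x}"

(* The conjunct s \<le> card E is part of the usual convention: without it every action on
   fewer than s points would be s-transitive vacuously. *)
definition transitive_of_degree ::
  "('g, 'b) monoid_scheme \<Rightarrow> 'x set \<Rightarrow> ('x \<Rightarrow> 'g \<Rightarrow> 'x) \<Rightarrow> nat \<Rightarrow> bool" where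
  "transitive_of_degree G E act s \<longleftrightarrow> s \<le> card E \<and>
     (\<forall>xs ys. length xs = s \<and> distinct xs \<and> set xs \<subseteq> E \<and>
              length ys = s \<and> distinct ys \<and> set ys \<subseteq> E
        \<longrightarrow> (\<exists>g\<in>carrier G. map (\<lambda>x. act x g) xs = ys))"

(* An undirected graph is encoded as a symmetric pair digraph; the unordered edge {d, s d}
   yields both arcs. *)
definition Cay :: "('g, 'b) monoid_scheme \<Rightarrow> 'g set \<Rightarrow> 'g pair_pre_digraph" where
  "Cay D S = \<lparr>pverts = carrier D,
              parcs = {(u, v). \<exists>d\<in>carrier D. \<exists>s\<in>S. {u, v} = {d, s \<otimes>\<^bsub>D\<^esub> d}}\<rparr>"

definition connected_normal_connection_set :: "('g, 'b) monoid_scheme \<Rightarrow> 'g set \<Rightarrow> bool" where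
  "connected_normal_connection_set G T \<longleftrightarrow>
     T \<subseteq> carrier G \<and> \<one>\<^bsub>G\<^esub> \<notin> T \<and> set_inv\<^bsub>G\<^esub> T = T \<and> generate G T = carrier G \<and>
     (\<forall>g\<in>carrier G. \<forall>t\<in>T. g \<otimes>\<^bsub>G\<^esub> t \<otimes>\<^bsub>G\<^esub> inv\<^bsub>G\<^esub> g \<in> T)"

(* Second largest eigenvalue, with multiplicity, of a real symmetric matrix of dimension at
   least 2: all roots of the characteristic polynomial are then real, and proots counts each
   with its multiplicity. *)
definition mat_lambda2 :: "real mat \<Rightarrow> real" where
  "mat_lambda2 A = rev (sorted_list_of_multiset (proots (char_poly A))) ! 1"

definition adjacency_mat :: "'v pair_pre_digraph \<Rightarrow> 'v list \<Rightarrow> real mat" where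
  "adjacency_mat H vs =
     mat (length vs) (length vs) (\<lambda>(i, j). if (vs ! i, vs ! j) \<in> parcs H then 1 else 0)"

(* Two enumerations of the vertices give adjacency matrices that are conjugate by a
   permutation matrix, so the choice does not affect the value. *)
definition graph_lambda2 :: "'v pair_pre_digraph \<Rightarrow> real" where
  "graph_lambda2 H =
     mat_lambda2 (adjacency_mat H (SOME vs. distinct vs \<and> set vs = pverts H))"

definition T_sub :: "nat \<Rightarrow> (nat \<Rightarrow> 'g \<Rightarrow> nat) \<Rightarrow> 'g set \<Rightarrow> nat \<Rightarrow> 'g set" where
  "T_sub n act T k = {t \<in> T. {1..k} \<subseteq> supp {1..n} act t}"

(* For i = 0 the interval is empty and this is the whole group. *)
definition tail_stabilizer ::
  "('g, 'b) monoid_scheme \<Rightarrow> nat \<Rightarrow> (nat \<Rightarrow> 'g \<Rightarrow> nat) \<Rightarrow> nat \<Rightarrow> 'g set" where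
  "tail_stabilizer G n act i = pointwise_stabilizer G act {n - i + 1..n}"

definition Cay_sub ::
  "('g, 'b) monoid_scheme \<Rightarrow> nat \<Rightarrow> (nat \<Rightarrow> 'g \<Rightarrow> nat) \<Rightarrow> 'g set \<Rightarrow> nat \<Rightarrow> nat
     \<Rightarrow> 'g pair_pre_digraph" where
  "Cay_sub G n act T k i =
     Cay (G\<lparr>carrier := tail_stabilizer G n act i\<rparr>) (T_sub n act T k \<inter> tail_stabilizer G n act i)"

(* Matrix indices start at 0, points at 1. *)
definition B_Pi ::
  "('g, 'b) monoid_scheme \<Rightarrow> nat \<Rightarrow> (nat \<Rightarrow> 'g \<Rightarrow> nat) \<Rightarrow> 'g set \<Rightarrow> nat \<Rightarrow> nat \<Rightarrow> real mat" where
  "B_Pi G n act T k i = mat (n - i) (n - i) (\<lambda>(s, t).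
     real (card (T_sub n act T k \<inter> tail_stabilizer G n act i
                  \<inter> transporter G act (Suc t) (Suc s))))"

end

theory Submission
  imports Defs "Jordan_Normal_Form.Schur_Decomposition" "HOL-Combinatorics.Transposition"
begin

text \<open>On the orthogonal complement of the constants, \<open>\<lambda>\<^sub>2\<close> of a regular graph or of a quotient matrix is the
  top eigenvalue. The quotient matrix is invariant under permutations of \<open>{1..k}\<close> and of
  \<open>{k+1..n}\<close>, so its eigenvectors are explicit and \<open>\<lambda>\<^sub>2 = |T\<^sub>k \<inter> \<Gamma>\<^bsub>k+1\<^esub>| - |T\<^sub>k \<inter> \<Gamma>\<^bsub>k+2,k+1\<^esub>|\<close>; call this
  number \<open>\<mu>\<^sub>k\<close>. An eigenvector of \<open>G\<^sub>k\<close> that is not orthogonal to all transporters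
  \<open>\<Gamma>\<^bsub>j,i\<^esub>\<close> projects to an eigenvector of the quotient matrix. On the orthogonal complement of the
  transporters, split \<open>T\<^sub>k\<close> into the elements fixing \<open>n\<close>, which act inside the cosets of the
  stabilizer of \<open>n\<close> and contribute at most the value \<open>\<mu>'\<^sub>k\<close> belonging to that stabilizer, and the
  elements moving \<open>n\<close>, a conjugate of \<open>T\<^bsub>k+1\<^esub>\<close>. Since \<open>\<mu>\<^sub>k = \<mu>'\<^sub>k + \<mu>\<^bsub>k+1\<^esub>\<close>, descending induction on
  \<open>k\<close> bounds the quadratic form by \<open>\<mu>\<^sub>k\<close>, and induction on \<open>a\<close> reaches the given stabilizer.\<close>

section \<open>The spectral theorem and the second eigenvalue\<close>

lemma sum_symmetric_form:
  fixes w :: "'a \<Rightarrow> 'a \<Rightarrow> 'b::comm_semiring_0"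
  assumes "\<And>x y. x \<in> V \<Longrightarrow> y \<in> V \<Longrightarrow> w x y = w y x"
  shows "(\<Sum>x\<in>V. f x * (\<Sum>y\<in>V. w x y * g y)) = (\<Sum>x\<in>V. g x * (\<Sum>y\<in>V. w x y * f y))"
proof -
  have "(\<Sum>x\<in>V. f x * (\<Sum>y\<in>V. w x y * g y)) = (\<Sum>x\<in>V. \<Sum>y\<in>V. f x * (w x y * g y))"
    by (simp add: sum_distrib_left)
  also have "\<dots> = (\<Sum>y\<in>V. \<Sum>x\<in>V. f x * (w x y * g y))"
    by (rule sum.swap)
  also have "\<dots> = (\<Sum>y\<in>V. g y * (\<Sum>x\<in>V. w y x * f x))"
    unfolding sum_distrib_left
    by (intro sum.cong refl) (simp add: assms ac_simps)
  finally show ?thesis .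
qed

lemma mult_mat_vec_entry:
  assumes "A \<in> carrier_mat n n" "v \<in> carrier_vec n" "i < n"
  shows "(A *\<^sub>v v) $ i = (\<Sum>j<n. A $$ (i, j) * v $ j)"
  using assms by (simp add: scalar_prod_def atLeast0LessThan)

text \<open>Over the complex numbers the polynomial splits. If \<open>v\<close> is an eigenvector
  for a root \<open>a\<close>, the Hermitian form of \<open>A\<close> at \<open>v\<close> is real by
  symmetry and equals \<open>a\<close> times the squared norm of \<open>v\<close>, so
  \<open>a\<close> is real.\<close>

lemma real_symmetric_char_poly_splits:
  fixes A :: "real mat"
  assumes A: "A \<in> carrier_mat n n"
    and sym: "\<And>i j. i < n \<Longrightarrow> j < n \<Longrightarrow> A $$ (i, j) = A $$ (j, i)"
  shows "\<exists>es. char_poly A = (\<Prod>e\<leftarrow>es. [:- e, 1:])"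
proof -
  let ?C = "map_mat complex_of_real A"
  have C: "?C \<in> carrier_mat n n" using A by simp
  obtain as where as: "char_poly ?C = (\<Prod>a\<leftarrow>as. [:- a, 1:])"
    using char_poly_factorized[OF C] by blast
  have real: "complex_of_real (Re a) = a" if "a \<in> set as" for a
  proof -
    have "poly (char_poly ?C) a = 0"
      unfolding as using that by (induction as) auto
    then obtain v where v: "v \<in> carrier_vec n" "v \<noteq> 0\<^sub>v n" "?C *\<^sub>v v = a \<cdot>\<^sub>v v"
      using eigenvalue_root_char_poly[OF C] C unfolding eigenvalue_def eigenvector_def by auto
    have ev: "(\<Sum>j<n. complex_of_real (A $$ (i, j)) * v $ j) = a * v $ i" if "i < n" for i
      using mult_mat_vec_entry[OF C v(1) that] v that A by simp
    define q where "q = (\<Sum>i<n. cnj (v $ i) * (\<Sum>j<n. complex_of_real (A $$ (i, j)) * v $ j))"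
    define N where "N = (\<Sum>i<n. (cmod (v $ i))\<^sup>2)"
    have "q = (\<Sum>i<n. v $ i * (\<Sum>j<n. complex_of_real (A $$ (i, j)) * cnj (v $ j)))"
      unfolding q_def by (rule sum_symmetric_form) (use sym in auto)
    also have "\<dots> = cnj q" unfolding q_def by simp
    finally have "q = cnj q" .
    moreover have "q = a * of_real N"
    proof -
      have "q = (\<Sum>i<n. a * (v $ i * cnj (v $ i)))"
        unfolding q_def by (intro sum.cong refl) (simp add: ev)
      moreover have "complex_of_real N = (\<Sum>i<n. v $ i * cnj (v $ i))"
        unfolding N_def of_real_sum complex_norm_square ..
      ultimately show ?thesis by (simp add: sum_distrib_left)
    qed
    moreover have "N \<noteq> 0"
    proof
      assume "N = 0"
      then have "\<forall>i<n. v $ i = 0" unfolding N_def by (subst (asm) sum_nonneg_eq_0_iff) auto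
      then show False using v(1,2) by auto
    qed
    ultimately have "a = cnj a" by simp
    then show ?thesis by (simp add: complex_eq_iff)
  qed
  interpret h: map_poly_inj_idom_hom complex_of_real ..
  \<comment> \<open>The product built from the real parts is compared with
    \<open>char_poly A\<close> after embedding both into complex polynomials, which is
    injective.\<close>
  let ?p = "\<Prod>e\<leftarrow>map Re as. [:- e, 1:]"
  have "map_poly complex_of_real ?p = (\<Prod>a\<leftarrow>as. [:- a, 1:])"
    using real
  proof (induction as)
    case (Cons a as)
    have "map_poly complex_of_real ([:- Re a, 1:] * (\<Prod>e\<leftarrow>map Re as. [:- e, 1:]))
        = map_poly complex_of_real [:- Re a, 1:] * map_poly complex_of_real (\<Prod>e\<leftarrow>map Re as. [:- e, 1:])"
      by (rule h.hom_mult)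
    then show ?case using Cons by (simp add: map_poly_pCons)
  qed simp
  also have "\<dots> = map_poly complex_of_real (char_poly A)"
    unfolding as[symmetric] by (rule of_real_hom.char_poly_hom[OF A])
  finally have "?p = char_poly A" by (rule h.injectivity)
  then show ?thesis by metis
qed

text \<open>Schur triangulation yields a flag of invariant subspaces; orthogonalizing a basis adapted to the
  flag turns it into eigenvectors, because a symmetric matrix also preserves orthogonal complements.\<close>

lemma real_symmetric_eigenbasis:
  fixes A :: "real mat"
  assumes A: "A \<in> carrier_mat n n"
    and sym: "\<And>i j. i < n \<Longrightarrow> j < n \<Longrightarrow> A $$ (i, j) = A $$ (j, i)"
    and split: "char_poly A = (\<Prod>e\<leftarrow>es. [:- e, 1:])"
  shows "\<exists>u :: nat \<Rightarrow> nat \<Rightarrow> real.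
    (\<forall>k<n. (\<Sum>i<n. u k i * u k i) > 0) \<and>
    (\<forall>k<n. \<forall>i<n. (\<Sum>j<n. A $$ (i, j) * u k j) = es ! k * u k i) \<and>
    (\<forall>k<n. \<forall>l<n. k \<noteq> l \<longrightarrow> (\<Sum>i<n. u k i * u l i) = 0) \<and>
    (\<forall>f. \<exists>c. \<forall>i<n. f i = (\<Sum>k<n. c k * u k i))"
proof -
  obtain B P Q where schur: "schur_decomposition A es = (B, P, Q)" by (metis prod_cases3)
  from schur_decomposition[OF A split schur]
  have wit: "similar_mat_wit A B P Q" and ut: "upper_triangular B" and diag: "diag_mat B = es" by auto
  from similar_mat_witD2[OF A wit]
  have B: "B \<in> carrier_mat n n" and P: "P \<in> carrier_mat n n" and Q: "Q \<in> carrier_mat n n"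
    and PQ: "P * Q = 1\<^sub>m n" and QP: "Q * P = 1\<^sub>m n" and APBQ: "A = P * B * Q" by auto
  have es: "es ! k = B $$ (k, k)" if "k < n" for k
    using diag B that by (auto simp: diag_mat_def)
  define p where "p k i = P $$ (i, k)" for k i
  define ip where "ip f g = (\<Sum>i<n. f i * g i)" for f g :: "nat \<Rightarrow> real"
  define ap where "ap f i = (\<Sum>j<n. A $$ (i, j) * f j)" for f i
  have entry: "(X * Y) $$ (i, k) = (\<Sum>j<n. X $$ (i, j) * Y $$ (j, k))"
    if "X \<in> carrier_mat n n" "Y \<in> carrier_mat n n" "i < n" "k < n" for X Y :: "real mat" and i k
    using that by (simp add: scalar_prod_def atLeast0LessThan)
  have AP: "A * P = P * B"
    unfolding APBQ using P B Q QP by (simp add: assoc_mult_mat[of _ n n _ n _ n])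
  \<comment> \<open>This is column \<open>k\<close> of \<open>A * P = P * B\<close>; upper
    triangularity of \<open>B\<close> cuts the sum off at \<open>k\<close>.\<close>
  have ap_p: "ap (p k) i = es ! k * p k i + (\<Sum>j<k. B $$ (j, k) * p j i)" if "k < n" "i < n" for k i
  proof -
    have "ap (p k) i = (A * P) $$ (i, k)"
      unfolding ap_def p_def using entry[OF A P] that by simp
    also have "\<dots> = (\<Sum>j<n. P $$ (i, j) * B $$ (j, k))"
      unfolding AP using entry[OF P B] that by simp
    also have "\<dots> = (\<Sum>j<Suc k. P $$ (i, j) * B $$ (j, k))"
      by (rule sum.mono_neutral_right) (use that ut B in \<open>auto simp: upper_triangular_def\<close>)
    finally show ?thesis using es[OF that(1)] by (simp add: p_def mult.commute)
  qed
  have coord: "f i = (\<Sum>k<n. (\<Sum>j<n. Q $$ (k, j) * f j) * p k i)" if "i < n" for f i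
  proof -
    have "(\<Sum>k<n. (\<Sum>j<n. Q $$ (k, j) * f j) * p k i) = (\<Sum>k<n. \<Sum>j<n. P $$ (i, k) * Q $$ (k, j) * f j)"
      by (simp add: p_def sum_distrib_left sum_distrib_right ac_simps)
    also have "\<dots> = (\<Sum>j<n. (P * Q) $$ (i, j) * f j)"
      by (subst sum.swap) (use that entry[OF P Q] in \<open>simp add: sum_distrib_right\<close>)
    also have "\<dots> = (\<Sum>j<n. (if j = i then f j else 0))"
      unfolding PQ using that by (intro sum.cong) auto
    finally show ?thesis using that by simp
  qed
  \<comment> \<open>The columns of \<open>P\<close> are independent because \<open>Q\<close> is a
    left inverse of \<open>P\<close>.\<close>
  have indep: "c k = 0" if "\<And>i. i < n \<Longrightarrow> (\<Sum>j<n. c j * p j i) = 0" "k < n" for c k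
  proof -
    have "c k = (\<Sum>j<n. (Q * P) $$ (k, j) * c j)"
      unfolding QP using that(2) by (simp add: if_distrib[of "\<lambda>x. x * _"] cong: if_cong)
    also have "\<dots> = (\<Sum>j<n. \<Sum>i<n. Q $$ (k, i) * (c j * p j i))"
      by (intro sum.cong refl)
        (simp add: entry[OF Q P that(2)] p_def sum_distrib_right mult.assoc mult.commute[of "c _"])
    also have "\<dots> = (\<Sum>i<n. Q $$ (k, i) * (\<Sum>j<n. c j * p j i))"
      by (subst sum.swap) (simp add: sum_distrib_left)
    finally show ?thesis using that(1) by simp
  qed
  have self: "ip f (ap g) = ip g (ap f)" for f g
    unfolding ip_def ap_def by (rule sum_symmetric_form) (use sym in auto)
  \<comment> \<open>The last two clauses say that the \<open>u l\<close> and the \<open>p l\<close>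
    with \<open>l \<le> k\<close> are related by unitriangular changes of basis in both directions,
    hence span the same member of the flag.\<close>
  define good where "good u k \<longleftrightarrow> ip (u k) (u k) > 0 \<and> (\<forall>i<n. ap (u k) i = es ! k * u k i) \<and>
      (\<forall>l<k. ip (u k) (u l) = 0) \<and> (\<exists>c. \<forall>i<n. p k i = u k i + (\<Sum>l<k. c l * u l i)) \<and>
      (\<exists>c. \<forall>i<n. u k i = p k i + (\<Sum>l<k. c l * p l i))" for u :: "nat \<Rightarrow> nat \<Rightarrow> real" and k
  have "\<exists>u. \<forall>k<m. good u k" if "m \<le> n" for m
    using that
  proof (induction m)
    case (Suc m)
    then obtain u where "\<forall>k<m. good u k" by auto
    then have u: "\<And>k. k < m \<Longrightarrow> ip (u k) (u k) > 0"
      "\<And>k i. k < m \<Longrightarrow> i < n \<Longrightarrow> ap (u k) i = es ! k * u k i"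
      "\<And>k l. k < m \<Longrightarrow> l < k \<Longrightarrow> ip (u k) (u l) = 0"
      "\<And>k. k < m \<Longrightarrow> \<exists>c. \<forall>i<n. p k i = u k i + (\<Sum>l<k. c l * u l i)"
      "\<And>k. k < m \<Longrightarrow> \<exists>c. \<forall>i<n. u k i = p k i + (\<Sum>l<k. c l * p l i)"
      unfolding good_def by simp_all
    have mn: "m < n" using Suc by simp
    have orth: "ip (u k) (u l) = 0" if "k < m" "l < m" "k \<noteq> l" for k l
      using u(3)[of k l] u(3)[of l k] that
      by (cases "l < k") (auto simp: ip_def mult.commute)
    \<comment> \<open>\<open>d\<close> holds the Gram-Schmidt coefficients and \<open>v\<close> is
      what remains of \<open>p m\<close> after projecting onto the earlier
      \<open>u l\<close>.\<close>
    define d where "d l = ip (p m) (u l) / ip (u l) (u l)" for l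
    define v where "v i = p m i - (\<Sum>l<m. d l * u l i)" for i
    have ip_sum: "ip (\<lambda>i. \<Sum>l<m. c l * u l i) (u j) = c j * ip (u j) (u j)" if "j < m" for c j
    proof -
      have "ip (\<lambda>i. \<Sum>l<m. c l * u l i) (u j) = (\<Sum>l<m. c l * ip (u l) (u j))"
        unfolding ip_def sum_distrib_right sum_distrib_left
        by (subst sum.swap) (simp add: ac_simps)
      also have "\<dots> = (\<Sum>l<m. if l = j then c l * ip (u l) (u j) else 0)"
        by (intro sum.cong refl) (use orth that in auto)
      finally show ?thesis using that by simp
    qed
    have v_orth: "ip v (u j) = 0" if "j < m" for j
    proof -
      have "ip v (u j) = ip (p m) (u j) - ip (\<lambda>i. \<Sum>l<m. d l * u l i) (u j)"
        unfolding ip_def v_def by (simp add: left_diff_distrib sum_subtractf)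
      also have "\<dots> = ip (p m) (u j) - d j * ip (u j) (u j)" by (simp only: ip_sum that)
      finally show ?thesis using u(1)[OF that] by (simp add: d_def)
    qed
    have p_span: "\<exists>c. \<forall>i<n. p k i = (\<Sum>l<m. c l * u l i)" if k: "k < m" for k
    proof -
      obtain c where c: "\<forall>i<n. p k i = u k i + (\<Sum>l<k. c l * u l i)" using u(4)[OF k] by blast
      have "(\<Sum>l<m. (if l < k then c l else if l = k then 1 else 0) * u l i) = 
            (\<Sum>l<Suc k. (if l < k then c l else if l = k then 1 else 0) * u l i)" for i
        by (rule sum.mono_neutral_right) (use k in auto)
      then show ?thesis
        using c by (intro exI[of _ "\<lambda>l. if l < k then c l else if l = k then 1 else 0"]) simp
    qed
    then obtain P' where P': "\<And>k i. k < m \<Longrightarrow> i < n \<Longrightarrow> p k i = (\<Sum>l<m. P' k l * u l i)" by metis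
    have u_span: "\<exists>c. \<forall>i<n. u k i = (\<Sum>l<m. c l * p l i)" if k: "k < m" for k
    proof -
      obtain c where c: "\<forall>i<n. u k i = p k i + (\<Sum>l<k. c l * p l i)" using u(5)[OF k] by blast
      have "(\<Sum>l<m. (if l < k then c l else if l = k then 1 else 0) * p l i) = 
            (\<Sum>l<Suc k. (if l < k then c l else if l = k then 1 else 0) * p l i)" for i
        by (rule sum.mono_neutral_right) (use k in auto)
      then show ?thesis
        using c by (intro exI[of _ "\<lambda>l. if l < k then c l else if l = k then 1 else 0"]) simp
    qed
    then obtain U' where U': "\<And>k i. k < m \<Longrightarrow> i < n \<Longrightarrow> u k i = (\<Sum>l<m. U' k l * p l i)" by metis
    have v_p: "\<exists>c. \<forall>i<n. v i = p m i + (\<Sum>l<m. c l * p l i)"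
    proof (intro exI[of _ "\<lambda>l. - (\<Sum>k<m. d k * U' k l)"] allI impI)
      fix i assume i: "i < n"
      have "(\<Sum>k<m. d k * u k i) = (\<Sum>k<m. \<Sum>l<m. d k * U' k l * p l i)"
        using U' i by (simp add: sum_distrib_left ac_simps)
      also have "\<dots> = (\<Sum>l<m. (\<Sum>k<m. d k * U' k l) * p l i)"
        by (subst sum.swap) (simp add: sum_distrib_right)
      finally show "v i = p m i + (\<Sum>l<m. - (\<Sum>k<m. d k * U' k l) * p l i)"
        by (simp add: v_def sum_negf)
    qed
    \<comment> \<open>If \<open>v\<close> vanished, \<open>v_p\<close> would be a linear relation
      among the columns of \<open>P\<close> in which column \<open>m\<close> has coefficient
      1.\<close>
    have v_pos: "ip v v > 0"
    proof (rule ccontr)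
      assume "\<not> ip v v > 0"
      moreover have "ip v v \<ge> 0" unfolding ip_def by (simp add: sum_nonneg)
      ultimately have "(\<Sum>i<n. v i * v i) = 0" unfolding ip_def by linarith
      then have v0: "v i = 0" if "i < n" for i
        using that by (subst (asm) sum_nonneg_eq_0_iff) auto
      obtain c where c: "\<forall>i<n. v i = p m i + (\<Sum>l<m. c l * p l i)" using v_p by blast
      let ?c = "\<lambda>l. if l < m then c l else if l = m then 1 else 0"
      have "(\<Sum>l<n. ?c l * p l i) = 0" if "i < n" for i
      proof -
        have "(\<Sum>l<n. ?c l * p l i) = (\<Sum>l<Suc m. ?c l * p l i)"
          by (rule sum.mono_neutral_right) (use mn in auto)
        then show ?thesis using c v0 that by auto
      qed
      from indep[of ?c m, OF this mn] show False by simp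
    qed
    \<comment> \<open>Write \<open>ap v\<close> in terms of \<open>v\<close> and the
      \<open>u l\<close>: the three summands come from the part of column \<open>m\<close> of
      \<open>B\<close> above the diagonal, from replacing \<open>p m\<close> by \<open>v\<close>,
      and from the subtracted projections.\<close>
    define r where "r l = (\<Sum>k<m. B $$ (k, m) * P' k l) + es ! m * d l - es ! l * d l" for l
    have ap_v: "ap v i = es ! m * v i + (\<Sum>l<m. r l * u l i)" if i: "i < n" for i
    proof -
      have "ap v i = ap (p m) i - (\<Sum>l<m. d l * ap (u l) i)"
        unfolding ap_def v_def right_diff_distrib sum_subtractf sum_distrib_left
        by (subst sum.swap) (simp add: ac_simps)
      also have "(\<Sum>l<m. d l * ap (u l) i) = (\<Sum>l<m. es ! l * d l * u l i)"
        using u(2) i by (simp add: ac_simps)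
      also have "ap (p m) i = es ! m * p m i + (\<Sum>k<m. B $$ (k, m) * p k i)"
        using ap_p[OF mn i] .
      also have "(\<Sum>k<m. B $$ (k, m) * p k i) = (\<Sum>k<m. \<Sum>l<m. B $$ (k, m) * P' k l * u l i)"
        using P' i by (simp add: sum_distrib_left ac_simps)
      also have "\<dots> = (\<Sum>l<m. (\<Sum>k<m. B $$ (k, m) * P' k l) * u l i)"
        by (subst sum.swap) (simp add: sum_distrib_right)
      also have "es ! m * p m i = es ! m * v i + (\<Sum>l<m. es ! m * d l * u l i)"
        by (simp add: v_def right_diff_distrib sum_distrib_left ac_simps)
      finally show ?thesis
        by (simp add: r_def sum.distrib sum_subtractf distrib_right left_diff_distrib)
    qed
    \<comment> \<open>Pairing \<open>ap v\<close> with \<open>u j\<close> leaves \<open>r j\<close>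
      times the squared norm of \<open>u j\<close>. By self-adjointness the same number is
      \<open>es ! j\<close> times the product of \<open>v\<close> and \<open>u j\<close>, which is
      zero.\<close>
    have r0: "r j = 0" if j: "j < m" for j
    proof -
      have "ip (u j) (ap v) = es ! m * ip v (u j) + ip (\<lambda>i. \<Sum>l<m. r l * u l i) (u j)"
        unfolding ip_def by (simp add: ap_v distrib_left sum.distrib sum_distrib_left ac_simps)
      moreover have "ip v (ap (u j)) = es ! j * ip v (u j)"
        unfolding ip_def using u(2)[OF j] by (simp add: sum_distrib_left ac_simps)
      ultimately have "r j * ip (u j) (u j) = 0"
        using self[of v "u j"] v_orth[OF j] ip_sum[OF j, of r] by simp
      then show ?thesis using u(1)[OF j] by simp
    qed
    have P_v: "\<exists>c. \<forall>i<n. p m i = v i + (\<Sum>l<m. c l * u l i)"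
      by (intro exI[of _ d]) (simp add: v_def)
    show ?case
    proof (intro exI[of _ "u(m := v)"] allI impI)
      fix k assume "k < Suc m"
      then consider "k < m" | "k = m" by linarith
      then show "good (u(m := v)) k"
      proof cases
        case 1
        moreover from 1 have "(\<Sum>l<k. c l * (u(m := v)) l i) = (\<Sum>l<k. c l * u l i)" for c i
          by (intro sum.cong) auto
        ultimately show ?thesis using u by (simp add: good_def)
      next
        case 2
        moreover have "(\<Sum>l<m. c l * (u(m := v)) l i) = (\<Sum>l<m. c l * u l i)" for c i
          by (intro sum.cong) auto
        ultimately show ?thesis using v_pos ap_v r0 v_orth v_p P_v by (simp add: good_def)
      qed
    qed
  qed simp
  from this[OF order_refl] obtain u where "\<forall>k<n. good u k" by blast
  then have u: "\<And>k. k < n \<Longrightarrow> ip (u k) (u k) > 0"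
    "\<And>k i. k < n \<Longrightarrow> i < n \<Longrightarrow> ap (u k) i = es ! k * u k i"
    "\<And>k l. k < n \<Longrightarrow> l < k \<Longrightarrow> ip (u k) (u l) = 0"
    "\<And>k. k < n \<Longrightarrow> \<exists>c. \<forall>i<n. p k i = u k i + (\<Sum>l<k. c l * u l i)"
    unfolding good_def by simp_all
  have p_span: "\<exists>c. \<forall>i<n. p k i = (\<Sum>l<n. c l * u l i)" if k: "k < n" for k
  proof -
    obtain c where c: "\<forall>i<n. p k i = u k i + (\<Sum>l<k. c l * u l i)" using u(4)[OF k] by blast
    have "(\<Sum>l<n. (if l < k then c l else if l = k then 1 else 0) * u l i) = 
          (\<Sum>l<Suc k. (if l < k then c l else if l = k then 1 else 0) * u l i)" for i
      by (rule sum.mono_neutral_right) (use k in auto)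
    then show ?thesis
      using c by (intro exI[of _ "\<lambda>l. if l < k then c l else if l = k then 1 else 0"]) simp
  qed
  then obtain P' where P': "\<And>k i. k < n \<Longrightarrow> i < n \<Longrightarrow> p k i = (\<Sum>l<n. P' k l * u l i)" by metis
  show ?thesis
  proof (intro exI[of _ u] conjI allI impI)
    show "(\<Sum>i<n. u k i * u k i) > 0" if "k < n" for k using u(1)[OF that] by (simp add: ip_def)
    show "(\<Sum>j<n. A $$ (i, j) * u k j) = es ! k * u k i" if "k < n" "i < n" for k i
      using u(2)[OF that] by (simp add: ap_def)
    show "(\<Sum>i<n. u k i * u l i) = 0" if "k < n" "l < n" "k \<noteq> l" for k l
      using u(3)[of k l] u(3)[of l k] that by (cases "l < k") (auto simp: ip_def mult.commute)
    fix f
    define a where "a k = (\<Sum>j<n. Q $$ (k, j) * f j)" for k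
    have "f i = (\<Sum>l<n. (\<Sum>k<n. a k * P' k l) * u l i)" if i: "i < n" for i
    proof -
      have "f i = (\<Sum>k<n. a k * p k i)" using coord[OF i] by (simp add: a_def)
      also have "\<dots> = (\<Sum>k<n. \<Sum>l<n. a k * P' k l * u l i)"
        using P' i by (simp add: sum_distrib_left ac_simps)
      also have "\<dots> = (\<Sum>l<n. (\<Sum>k<n. a k * P' k l) * u l i)"
        by (subst sum.swap) (simp add: sum_distrib_right)
      finally show ?thesis .
    qed
    then show "\<exists>c. \<forall>i<n. f i = (\<Sum>k<n. c k * u k i)"
      by (intro exI[of _ "\<lambda>l. \<Sum>k<n. a k * P' k l"]) simp
  qed
qed

text \<open>Since \<open>d\<close> bounds the Rayleigh quotient, the constant vector is a top eigenvector, so the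
  second eigenvalue is the top one on its orthogonal complement.\<close>

lemma mat_lambda2_orthogonal_ones:
  fixes A :: "real mat"
  assumes A: "A \<in> carrier_mat n n" and n: "n \<ge> 2"
    and sym: "\<And>i j. i < n \<Longrightarrow> j < n \<Longrightarrow> A $$ (i, j) = A $$ (j, i)"
    and row: "\<And>i. i < n \<Longrightarrow> (\<Sum>j<n. A $$ (i, j)) = d"
    and top: "\<And>f. (\<Sum>i<n. f i * (\<Sum>j<n. A $$ (i, j) * f j)) \<le> d * (\<Sum>i<n. f i * f i)"
  shows "(\<Sum>i<n. f i) = 0 \<Longrightarrow>
           (\<Sum>i<n. f i * (\<Sum>j<n. A $$ (i, j) * f j)) \<le> mat_lambda2 A * (\<Sum>i<n. f i * f i)"
    and "\<exists>f. (\<Sum>i<n. f i) = 0 \<and> (\<exists>i<n. f i \<noteq> 0) \<and>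
           (\<forall>i<n. (\<Sum>j<n. A $$ (i, j) * f j) = mat_lambda2 A * f i)"
proof -
  define es where "es = rev (sorted_list_of_multiset (proots (char_poly A)))"
  have lam: "mat_lambda2 A = es ! 1" unfolding mat_lambda2_def es_def ..
  obtain es0 where es0: "char_poly A = (\<Prod>e\<leftarrow>es0. [:- e, 1:])"
    using real_symmetric_char_poly_splits[OF A sym] by blast
  \<comment> \<open>The factorization obtained above lists the roots in an unknown order. Since only
    their multiset matters, it can be rewritten with the decreasing list \<open>es\<close> on which
    \<open>mat_lambda2\<close> is defined.\<close>
  have "proots (\<Prod>e\<leftarrow>es0. [:- e, 1:]) = mset es0"
  proof (induction es0)
    case (Cons e es0)
    have "(\<Prod>e\<leftarrow>es0. [:- e, 1:]) \<noteq> 0" by (auto simp: prod_list_zero_iff)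
    then have "proots ([:- e, 1:] * (\<Prod>e\<leftarrow>es0. [:- e, 1:])) = {#e#} + mset es0"
      by (subst proots_mult) (simp_all add: Cons)
    then show ?case by simp
  qed simp
  then have perm: "mset es = mset es0" by (simp add: es_def es0)
  have split: "char_poly A = (\<Prod>e\<leftarrow>es. [:- e, 1:])"
    unfolding es0 prod_mset_prod_list[symmetric] mset_map perm ..
  have len: "length es = n"
  proof -
    obtain B P Q where schur: "schur_decomposition A es = (B, P, Q)" by (metis prod_cases3)
    from schur_decomposition[OF A split schur] similar_mat_witD2[OF A, of B P Q]
    show ?thesis by (auto simp: diag_mat_def)
  qed
  have "sorted (rev es)" by (simp add: es_def)
  then have desc: "es ! k \<le> es ! j" if "j \<le> k" "k < n" for j k
    using that by (intro sorted_rev_nth_mono) (auto simp: len)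
  obtain u :: "nat \<Rightarrow> nat \<Rightarrow> real" where u:
    "\<forall>k<n. (\<Sum>i<n. u k i * u k i) > 0"
    "\<forall>k<n. \<forall>i<n. (\<Sum>j<n. A $$ (i, j) * u k j) = es ! k * u k i"
    "\<forall>k<n. \<forall>l<n. k \<noteq> l \<longrightarrow> (\<Sum>i<n. u k i * u l i) = 0"
    and span: "\<forall>f. \<exists>c. \<forall>i<n. f i = (\<Sum>k<n. c k * u k i)"
    using real_symmetric_eigenbasis[OF A sym split] by blast
  from u have N_pos: "\<And>k. k < n \<Longrightarrow> (\<Sum>i<n. u k i * u k i) > 0"
    and ev: "\<And>k i. k < n \<Longrightarrow> i < n \<Longrightarrow> (\<Sum>j<n. A $$ (i, j) * u k j) = es ! k * u k i"
    and orth: "\<And>k l. k < n \<Longrightarrow> l < n \<Longrightarrow> k \<noteq> l \<Longrightarrow> (\<Sum>i<n. u k i * u l i) = 0"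
    by simp_all
  define N where "N k = (\<Sum>i<n. u k i * u k i)" for k
  have Np: "N k > 0" if "k < n" for k using N_pos[OF that] by (simp add: N_def)
  have coef: "(\<Sum>i<n. f i * u j i) = c j * N j"
    if c: "\<And>i. i < n \<Longrightarrow> f i = (\<Sum>k<n. c k * u k i)" and j: "j < n" for f c j
  proof -
    have "(\<Sum>i<n. f i * u j i) = (\<Sum>i<n. \<Sum>k<n. c k * (u k i * u j i))"
      by (intro sum.cong refl) (simp add: c sum_distrib_left ac_simps)
    also have "\<dots> = (\<Sum>k<n. c k * (\<Sum>i<n. u k i * u j i))"
      by (subst sum.swap) (simp add: sum_distrib_left)
    also have "\<dots> = (\<Sum>k<n. if k = j then c k * N k else 0)"
      by (intro sum.cong refl) (use orth j in \<open>auto simp: N_def\<close>)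
    finally show ?thesis using j by simp
  qed
  have norm: "(\<Sum>i<n. f i * f i) = (\<Sum>k<n. (c k)\<^sup>2 * N k)"
    and form: "(\<Sum>i<n. f i * (\<Sum>j<n. A $$ (i, j) * f j)) = (\<Sum>k<n. es ! k * ((c k)\<^sup>2 * N k))"
    if c: "\<And>i. i < n \<Longrightarrow> f i = (\<Sum>k<n. c k * u k i)" for f c
  proof -
    have "(\<Sum>i<n. f i * f i) = (\<Sum>i<n. \<Sum>k<n. c k * (f i * u k i))"
      by (intro sum.cong refl, subst (2) c) (auto simp: sum_distrib_left ac_simps)
    also have "\<dots> = (\<Sum>k<n. c k * (\<Sum>i<n. f i * u k i))"
      by (subst sum.swap) (simp add: sum_distrib_left)
    finally show "(\<Sum>i<n. f i * f i) = (\<Sum>k<n. (c k)\<^sup>2 * N k)"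
      using coef[of f c, OF c] by (simp add: power2_eq_square ac_simps)
    have Af: "(\<Sum>j<n. A $$ (i, j) * f j) = (\<Sum>k<n. c k * (es ! k * u k i))" if "i < n" for i
    proof -
      have "(\<Sum>j<n. A $$ (i, j) * f j) = (\<Sum>j<n. \<Sum>k<n. c k * (A $$ (i, j) * u k j))"
        by (intro sum.cong refl) (simp add: c sum_distrib_left ac_simps)
      also have "\<dots> = (\<Sum>k<n. c k * (\<Sum>j<n. A $$ (i, j) * u k j))"
        by (subst sum.swap) (simp add: sum_distrib_left)
      finally show ?thesis using ev that by simp
    qed
    have "(\<Sum>i<n. f i * (\<Sum>j<n. A $$ (i, j) * f j)) = (\<Sum>i<n. f i * (\<Sum>k<n. c k * (es ! k * u k i)))"
      by (intro sum.cong refl) (simp add: Af)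
    also have "\<dots> = (\<Sum>i<n. \<Sum>k<n. c k * es ! k * (f i * u k i))"
      by (simp add: sum_distrib_left ac_simps)
    also have "\<dots> = (\<Sum>k<n. c k * es ! k * (\<Sum>i<n. f i * u k i))"
      by (subst sum.swap) (simp add: sum_distrib_left)
    finally show "(\<Sum>i<n. f i * (\<Sum>j<n. A $$ (i, j) * f j)) = (\<Sum>k<n. es ! k * ((c k)\<^sup>2 * N k))"
      using coef[of f c, OF c] by (simp add: power2_eq_square ac_simps)
  qed
  have nz: "\<exists>i<n. u k i \<noteq> 0" if "k < n" for k
  proof (rule ccontr)
    assume "\<not> (\<exists>i<n. u k i \<noteq> 0)"
    then have "(\<Sum>i<n. u k i * u k i) = 0" by simp
    then show False using N_pos[OF that] by simp
  qed
  have bound: "(\<Sum>i<n. f i * (\<Sum>j<n. A $$ (i, j) * f j)) \<le> es ! 1 * (\<Sum>i<n. f i * f i)"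
    if c: "\<And>i. i < n \<Longrightarrow> f i = (\<Sum>k<n. c k * u k i)" and c0: "es ! 0 = es ! 1 \<or> c 0 = 0" for f c
  proof -
    have "(\<Sum>k<n. es ! k * ((c k)\<^sup>2 * N k)) \<le> (\<Sum>k<n. es ! 1 * ((c k)\<^sup>2 * N k))"
    proof (intro sum_mono)
      fix k assume k: "k \<in> {..<n}"
      have "es ! k \<le> es ! 1 \<or> c k = 0"
        using c0 desc[of 1 k] k by (cases "k = 0") auto
      then show "es ! k * ((c k)\<^sup>2 * N k) \<le> es ! 1 * ((c k)\<^sup>2 * N k)"
        using Np[of k] k by (cases "c k = 0") (auto intro!: mult_right_mono)
    qed
    also have "\<dots> = es ! 1 * (\<Sum>i<n. f i * f i)"
      by (simp only: norm[of f c, OF c] sum_distrib_left)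
    finally show ?thesis by (simp only: form[of f c, OF c])
  qed
  have "((\<Sum>i<n. f i) = 0 \<longrightarrow>
           (\<Sum>i<n. f i * (\<Sum>j<n. A $$ (i, j) * f j)) \<le> es ! 1 * (\<Sum>i<n. f i * f i)) \<and>
        (\<exists>f. (\<Sum>i<n. f i) = 0 \<and> (\<exists>i<n. f i \<noteq> 0) \<and>
           (\<forall>i<n. (\<Sum>j<n. A $$ (i, j) * f j) = es ! 1 * f i))" for f
  proof (cases "es ! 0 = es ! 1")
    \<comment> \<open>A repeated top eigenvalue bounds the form on all vectors. Its eigenspace
      contains \<open>u 0\<close> and \<open>u 1\<close>, so some nonzero combination of them has
      coordinate sum zero.\<close>
    case True
    have "\<exists>f. (\<Sum>i<n. f i) = 0 \<and> (\<exists>i<n. f i \<noteq> 0) \<and>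
           (\<forall>i<n. (\<Sum>j<n. A $$ (i, j) * f j) = es ! 1 * f i)"
    proof (cases "(\<Sum>i<n. u 0 i) = 0")
      case T0: True
      then show ?thesis using nz[of 0] ev[of 0] n True by (intro exI[of _ "u 0"]) auto
    next
      case False
      define a b where "a = (\<Sum>i<n. u 1 i)" and "b = (\<Sum>i<n. u 0 i)"
      define f where "f i = a * u 0 i - b * u 1 i" for i
      have "(\<Sum>i<n. f i) = 0"
        unfolding f_def sum_subtractf sum_distrib_left[symmetric] a_def b_def by simp
      moreover have "\<exists>i<n. f i \<noteq> 0"
      proof (rule ccontr)
        assume "\<not> (\<exists>i<n. f i \<noteq> 0)"
        then have "(\<Sum>i<n. f i * u 1 i) = 0" by simp
        moreover have "(\<Sum>i<n. f i * u 1 i) = a * (\<Sum>i<n. u 0 i * u 1 i) - b * N 1"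
          by (simp add: f_def N_def algebra_simps sum_subtractf sum_distrib_left)
        ultimately show False using orth[of 0 1] Np[of 1] False n by (simp add: b_def)
      qed
      moreover have "(\<Sum>j<n. A $$ (i, j) * f j) = es ! 1 * f i" if "i < n" for i
      proof -
        have "(\<Sum>j<n. A $$ (i, j) * f j)
            = a * (\<Sum>j<n. A $$ (i, j) * u 0 j) - b * (\<Sum>j<n. A $$ (i, j) * u 1 j)"
          by (simp add: f_def right_diff_distrib sum_subtractf sum_distrib_left ac_simps)
        then show ?thesis using ev[of 0 i] ev[of 1 i] that n True by (simp add: f_def algebra_simps)
      qed
      ultimately show ?thesis by blast
    qed
    moreover have "(\<Sum>i<n. f i * (\<Sum>j<n. A $$ (i, j) * f j)) \<le> es ! 1 * (\<Sum>i<n. f i * f i)"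
    proof -
      obtain c where c: "\<forall>i<n. f i = (\<Sum>k<n. c k * u k i)" using span by blast
      show ?thesis by (rule bound[of f c]) (use c True in auto)
    qed
    ultimately show ?thesis by blast
  next
    case False
    \<comment> \<open>The Rayleigh bound at \<open>u 0\<close> gives \<open>es ! 0 \<le> d\<close>,
      so all later eigenvalues lie strictly below \<open>d\<close>. The constant vector has
      eigenvalue \<open>d\<close>, hence is orthogonal to every \<open>u k\<close> with
      \<open>k \<ge> 1\<close>.\<close>
    then have lt: "es ! 1 < es ! 0" using desc[of 0 1] n by force
    have "(\<Sum>i<n. u 0 i * (\<Sum>j<n. A $$ (i, j) * u 0 j)) = (\<Sum>i<n. u 0 i * (es ! 0 * u 0 i))"
      by (intro sum.cong refl) (use ev[of 0] n in simp)
    also have "\<dots> = es ! 0 * N 0"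
      by (simp add: N_def sum_distrib_left ac_simps)
    finally have "es ! 0 * N 0 \<le> d * N 0"
      using top[of "u 0"] by (simp add: N_def)
    then have d: "es ! 0 \<le> d" using Np[of 0] n by simp
    have ones: "(\<Sum>i<n. u k i) = 0" if k: "1 \<le> k" "k < n" for k
    proof -
      have "(\<Sum>i<n. u k i * (\<Sum>j<n. A $$ (i, j) * 1)) = (\<Sum>i<n. 1 * (\<Sum>j<n. A $$ (i, j) * u k j))"
        by (rule sum_symmetric_form) (use sym in auto)
      then have "d * (\<Sum>i<n. u k i) = es ! k * (\<Sum>i<n. u k i)"
        using row ev k by (simp add: sum_distrib_left mult.commute)
      moreover have "es ! k < d" using desc[of 1 k] k lt d by linarith
      ultimately show ?thesis by simp
    qed
    \<comment> \<open>The constant vector turns out to be a multiple of \<open>u 0\<close>, so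
      coordinate sum zero means a vanishing coefficient at \<open>u 0\<close>.\<close>
    obtain c where c: "\<forall>i<n. 1 = (\<Sum>k<n. c k * u k i)" using spec[OF span, of "\<lambda>_. 1"] by blast
    have ck: "c k = 0" if "1 \<le> k" "k < n" for k
      using coef[of "\<lambda>_. 1" c k] c ones[OF that] Np[of k] that by auto
    have c0: "1 = c 0 * u 0 i" if "i < n" for i
    proof -
      have "(\<Sum>k<n. c k * u k i) = (\<Sum>k\<in>{0}. c k * u k i)"
        by (rule sum.mono_neutral_right) (use n ck in auto)
      then show ?thesis using c that by simp
    qed
    have "(\<Sum>i<n. f i * (\<Sum>j<n. A $$ (i, j) * f j)) \<le> es ! 1 * (\<Sum>i<n. f i * f i)"
      if f: "(\<Sum>i<n. f i) = 0" for f
    proof -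
      obtain b where b: "\<forall>i<n. f i = (\<Sum>k<n. b k * u k i)" using span by blast
      have "c 0 * (\<Sum>i<n. f i * u 0 i) = (\<Sum>i<n. f i * (c 0 * u 0 i))"
        by (simp add: sum_distrib_left ac_simps)
      also have "\<dots> = (\<Sum>i<n. f i * 1)"
        by (intro sum.cong refl arg_cong2[of _ _ _ _ times]) (use c0 in auto)
      finally have "(\<Sum>i<n. f i * u 0 i) = 0" using f c0[of 0] n by auto
      then have "b 0 = 0" using coef[of f b 0] b Np[of 0] n by simp
      then show ?thesis using bound[of f b] b by blast
    qed
    moreover have "\<exists>f. (\<Sum>i<n. f i) = 0 \<and> (\<exists>i<n. f i \<noteq> 0) \<and>
           (\<forall>i<n. (\<Sum>j<n. A $$ (i, j) * f j) = es ! 1 * f i)"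
      using ones[of 1] nz[of 1] ev[of 1] n by (intro exI[of _ "u 1"]) auto
    ultimately show ?thesis by blast
  qed
  then show "(\<Sum>i<n. f i) = 0 \<Longrightarrow>
           (\<Sum>i<n. f i * (\<Sum>j<n. A $$ (i, j) * f j)) \<le> mat_lambda2 A * (\<Sum>i<n. f i * f i)"
    and "\<exists>f. (\<Sum>i<n. f i) = 0 \<and> (\<exists>i<n. f i \<noteq> 0) \<and>
           (\<forall>i<n. (\<Sum>j<n. A $$ (i, j) * f j) = mat_lambda2 A * f i)"
    unfolding lam by blast+
qed

text \<open>Adjacency matrices and quotient matrices are both of this shape, which lets one
  variational statement about functions on a finite set serve both.\<close>

definition weight_mat :: "('a \<Rightarrow> 'a \<Rightarrow> real) \<Rightarrow> 'a list \<Rightarrow> real mat" where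
  "weight_mat w vs = mat (length vs) (length vs) (\<lambda>(i, j). w (vs ! i) (vs ! j))"

text \<open>The Rayleigh bound by \<open>d\<close> follows from
  \<open>2 * f i * f j \<le> f i * f i + f j * f j\<close>: weighted by the nonnegative entries,
  each square collects a full row sum. The rest is transport along the enumeration
  \<open>vs\<close>.\<close>

lemma weight_mat_lambda2:
  fixes w :: "'a \<Rightarrow> 'a \<Rightarrow> real"
  assumes vs: "distinct vs" "set vs = V" and card: "card V \<ge> 2"
    and sym: "\<And>x y. x \<in> V \<Longrightarrow> y \<in> V \<Longrightarrow> w x y = w y x"
    and nonneg: "\<And>x y. x \<in> V \<Longrightarrow> y \<in> V \<Longrightarrow> w x y \<ge> 0"
    and row: "\<And>x. x \<in> V \<Longrightarrow> (\<Sum>y\<in>V. w x y) = d"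
  shows "(\<Sum>x\<in>V. f x) = 0 \<Longrightarrow>
           (\<Sum>x\<in>V. f x * (\<Sum>y\<in>V. w x y * f y)) \<le> mat_lambda2 (weight_mat w vs) * (\<Sum>x\<in>V. f x * f x)"
    and "\<exists>f. (\<Sum>x\<in>V. f x) = 0 \<and> (\<exists>x\<in>V. f x \<noteq> 0) \<and>
           (\<forall>x\<in>V. (\<Sum>y\<in>V. w x y * f y) = mat_lambda2 (weight_mat w vs) * f x)"
proof -
  let ?A = "weight_mat w vs"
  define n where "n = length vs"
  have A: "?A \<in> carrier_mat n n" by (simp add: weight_mat_def n_def)
  have Aij: "?A $$ (i, j) = w (vs ! i) (vs ! j)" if "i < n" "j < n" for i j
    using that by (simp add: weight_mat_def n_def)
  have bij: "bij_betw ((!) vs) {..<n} V"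
    using bij_betw_nth[OF vs(1)] vs(2) by (simp add: n_def)
  have V: "vs ! i \<in> V" if "i < n" for i using that vs by (auto simp: n_def)
  have re: "(\<Sum>i<n. g (vs ! i)) = (\<Sum>x\<in>V. g x)" for g :: "'a \<Rightarrow> real"
    by (rule sum.reindex_bij_betw[OF bij])
  have n2: "n \<ge> 2" using card vs distinct_card[of vs] by (simp add: n_def)
  have Asym: "?A $$ (i, j) = ?A $$ (j, i)" if "i < n" "j < n" for i j
    using Aij that sym V by simp
  have Arow: "(\<Sum>j<n. ?A $$ (i, j)) = d" if "i < n" for i
    using Aij[OF that] re[of "w (vs ! i)"] row[OF V[OF that]] by simp
  have Atop: "(\<Sum>i<n. f i * (\<Sum>j<n. ?A $$ (i, j) * f j)) \<le> d * (\<Sum>i<n. f i * f i)" for f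
  proof -
    have "(\<Sum>i<n. f i * (\<Sum>j<n. ?A $$ (i, j) * f j))
        \<le> (\<Sum>i<n. \<Sum>j<n. ?A $$ (i, j) * (f i * f i) / 2 + ?A $$ (i, j) * (f j * f j) / 2)"
      unfolding sum_distrib_left
    proof (intro sum_mono)
      fix i j assume "i \<in> {..<n}" "j \<in> {..<n}"
      then have "0 \<le> ?A $$ (i, j) * (f i - f j)\<^sup>2" using Aij nonneg V by simp
      then show "f i * (?A $$ (i, j) * f j)
          \<le> ?A $$ (i, j) * (f i * f i) / 2 + ?A $$ (i, j) * (f j * f j) / 2"
        by (simp add: power2_eq_square algebra_simps)
    qed
    also have "\<dots> = (\<Sum>i<n. \<Sum>j<n. ?A $$ (i, j) * (f i * f i) / 2)
          + (\<Sum>i<n. \<Sum>j<n. ?A $$ (i, j) * (f j * f j) / 2)"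
      by (simp add: sum.distrib)
    also have "(\<Sum>i<n. \<Sum>j<n. ?A $$ (i, j) * (f j * f j) / 2)
        = (\<Sum>i<n. \<Sum>j<n. ?A $$ (i, j) * (f i * f i) / 2)"
      by (subst sum.swap) (intro sum.cong refl, simp add: Asym)
    also have "(\<Sum>i<n. \<Sum>j<n. ?A $$ (i, j) * (f i * f i) / 2) = (\<Sum>i<n. d * (f i * f i) / 2)"
      unfolding sum_divide_distrib[symmetric] sum_distrib_right[symmetric] using Arow by simp
    finally show ?thesis by (simp add: sum_distrib_left sum_divide_distrib[symmetric])
  qed
  note main = mat_lambda2_orthogonal_ones[OF A n2 Asym Arow Atop]
  have inner: "(\<Sum>j<n. ?A $$ (i, j) * f (vs ! j)) = (\<Sum>y\<in>V. w (vs ! i) y * f y)" if "i < n" for i f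
    using re[of "\<lambda>y. w (vs ! i) y * f y"] Aij[OF that] by simp
  show "(\<Sum>x\<in>V. f x) = 0 \<Longrightarrow>
           (\<Sum>x\<in>V. f x * (\<Sum>y\<in>V. w x y * f y)) \<le> mat_lambda2 ?A * (\<Sum>x\<in>V. f x * f x)"
    using main(1)[of "\<lambda>i. f (vs ! i)"] re[of f] re[of "\<lambda>x. f x * f x"]
      re[of "\<lambda>x. f x * (\<Sum>y\<in>V. w x y * f y)"] inner by simp
  obtain g where g: "(\<Sum>i<n. g i) = 0" "\<exists>i<n. g i \<noteq> 0"
    "\<forall>i<n. (\<Sum>j<n. ?A $$ (i, j) * g j) = mat_lambda2 ?A * g i" using main(2) by blast
  define f where "f x = g (the_inv_into {..<n} ((!) vs) x)" for x
  have fg: "f (vs ! i) = g i" if "i < n" for i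
    using the_inv_into_f_f[OF bij_betw_imp_inj_on[OF bij]] that by (simp add: f_def)
  have "(\<Sum>x\<in>V. f x) = 0" using re[of f] fg g(1) by simp
  moreover have "\<exists>x\<in>V. f x \<noteq> 0" using g(2) fg V by metis
  moreover have "(\<Sum>y\<in>V. w x y * f y) = mat_lambda2 ?A * f x" if x: "x \<in> V" for x
  proof -
    obtain i where i: "i < n" "x = vs ! i" using x bij unfolding bij_betw_def by auto
    have "(\<Sum>y\<in>V. w x y * f y) = (\<Sum>j<n. ?A $$ (i, j) * f (vs ! j))" using inner[OF i(1)] i by simp
    also have "\<dots> = (\<Sum>j<n. ?A $$ (i, j) * g j)" using fg by simp
    finally show ?thesis using g(3) fg i by simp
  qed
  ultimately show "\<exists>f. (\<Sum>x\<in>V. f x) = 0 \<and> (\<exists>x\<in>V. f x \<noteq> 0) \<and>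
           (\<forall>x\<in>V. (\<Sum>y\<in>V. w x y * f y) = mat_lambda2 ?A * f x)" by blast
qed

section \<open>Cayley graphs and highly transitive actions\<close>

lemma (in group) sum_mult_left:
  assumes "g \<in> carrier G"
  shows "(\<Sum>x\<in>carrier G. F (g \<otimes> x)) = (\<Sum>x\<in>carrier G. F x)"
  using assms
  by (intro sum.reindex_bij_witness[of _ "\<lambda>x. inv g \<otimes> x" "\<lambda>x. g \<otimes> x"])
    (auto simp: m_assoc[symmetric])

text \<open>Reading an edge from its other end replaces \<open>s\<close> by its inverse, which is
  again in \<open>S\<close>.\<close>

lemma (in group) Cay_arcs:
  assumes S: "S \<subseteq> carrier G" "\<And>s. s \<in> S \<Longrightarrow> inv s \<in> S" and x: "x \<in> carrier G"
  shows "{y. (x, y) \<in> parcs (Cay G S)} = (\<lambda>s. s \<otimes> x) ` S"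
proof (intro equalityI subsetI)
  fix y assume "y \<in> {y. (x, y) \<in> parcs (Cay G S)}"
  then obtain d s where d: "d \<in> carrier G" "s \<in> S" "{x, y} = {d, s \<otimes> d}" by (auto simp: Cay_def)
  then consider "x = d" "y = s \<otimes> d" | "x = s \<otimes> d" "y = d" by (auto simp: doubleton_eq_iff)
  then show "y \<in> (\<lambda>s. s \<otimes> x) ` S"
  proof cases
    case 2
    then have "y = inv s \<otimes> x" using d S(1) by (auto simp: m_assoc[symmetric])
    then show ?thesis using S(2) d by blast
  qed (use d in auto)
qed (use S x in \<open>auto simp: Cay_def\<close>)

text \<open>Left translates \<open>s \<otimes> x\<close> by different \<open>s\<close> are
  different, so a row of the adjacency matrix acts as a sum over \<open>S\<close> and the degree is
  \<open>card S\<close>. The argument works for any enumeration of the vertices, in particular the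
  one chosen by \<open>SOME\<close>.\<close>

lemma (in group) Cay_lambda2:
  assumes fin: "finite (carrier G)" and card: "card (carrier G) \<ge> 2"
    and S: "S \<subseteq> carrier G" "\<And>s. s \<in> S \<Longrightarrow> inv s \<in> S"
  shows "(\<Sum>x\<in>carrier G. f x) = 0 \<Longrightarrow>
      (\<Sum>x\<in>carrier G. f x * (\<Sum>s\<in>S. f (s \<otimes> x))) \<le> graph_lambda2 (Cay G S) * (\<Sum>x\<in>carrier G. f x * f x)"
    and "\<exists>f. (\<Sum>x\<in>carrier G. f x) = 0 \<and> (\<exists>x\<in>carrier G. f x \<noteq> 0) \<and>
      (\<forall>x\<in>carrier G. (\<Sum>s\<in>S. f (s \<otimes> x)) = graph_lambda2 (Cay G S) * f x)"
proof -
  let ?V = "carrier G"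
  define w :: "'a \<Rightarrow> 'a \<Rightarrow> real" where "w x y = (if (x, y) \<in> parcs (Cay G S) then 1 else 0)" for x y
  define vs where "vs = (SOME vs. distinct vs \<and> set vs = pverts (Cay G S))"
  have "pverts (Cay G S) = ?V" by (simp add: Cay_def)
  moreover obtain vs' where "distinct vs'" "set vs' = ?V" using finite_distinct_list[OF fin] by blast
  ultimately have vs: "distinct vs" "set vs = ?V"
    unfolding vs_def using someI[of "\<lambda>vs. distinct vs \<and> set vs = ?V" vs'] by auto
  have lam: "graph_lambda2 (Cay G S) = mat_lambda2 (weight_mat w vs)"
    unfolding graph_lambda2_def vs_def[symmetric] adjacency_mat_def weight_mat_def w_def ..
  have row: "(\<Sum>y\<in>?V. w x y * f y) = (\<Sum>s\<in>S. f (s \<otimes> x))" if x: "x \<in> ?V" for x f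
  proof -
    have "(\<Sum>y\<in>?V. w x y * f y) = (\<Sum>y\<in>(\<lambda>s. s \<otimes> x) ` S. w x y * f y)"
      using fin S x Cay_arcs[OF S x] by (intro sum.mono_neutral_right) (auto simp: w_def)
    also have "\<dots> = (\<Sum>y\<in>(\<lambda>s. s \<otimes> x) ` S. f y)"
      by (intro sum.cong refl) (use Cay_arcs[OF S x] in \<open>auto simp: w_def\<close>)
    also have "\<dots> = (\<Sum>s\<in>S. f (s \<otimes> x))"
      using S x by (subst sum.reindex) (auto simp: inj_on_def subset_iff)
    finally show ?thesis .
  qed
  have sym: "w x y = w y x" for x y by (simp add: w_def Cay_def insert_commute)
  have deg: "(\<Sum>y\<in>?V. w x y) = card S" if "x \<in> ?V" for x using row[OF that, of "\<lambda>_. 1"] by simp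
  note main = weight_mat_lambda2[OF vs card, of w "real (card S)", OF sym _ deg, folded lam]
  show "(\<Sum>x\<in>?V. f x) = 0 \<Longrightarrow>
      (\<Sum>x\<in>?V. f x * (\<Sum>s\<in>S. f (s \<otimes> x))) \<le> graph_lambda2 (Cay G S) * (\<Sum>x\<in>?V. f x * f x)"
    using main(1)[of f] row by (simp add: w_def)
  show "\<exists>f. (\<Sum>x\<in>?V. f x) = 0 \<and> (\<exists>x\<in>?V. f x \<noteq> 0) \<and>
      (\<forall>x\<in>?V. (\<Sum>s\<in>S. f (s \<otimes> x)) = graph_lambda2 (Cay G S) * f x)"
    using main(2) row by (simp add: w_def)
qed

section \<open>Counting connection elements by the points they move\<close>

definition moving :: "nat \<Rightarrow> (nat \<Rightarrow> 'g \<Rightarrow> nat) \<Rightarrow> 'g set \<Rightarrow> nat set \<Rightarrow> 'g set" where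
  "moving n act T X = {t \<in> T. X \<subseteq> supp {1..n} act t}"

text \<open>The set \<open>X\<close> is arbitrary because conjugation carries \<open>{1..k}\<close>
  to other sets. For \<open>X = {1..k}\<close> these are the entries of the quotient matrix.\<close>

definition moving_count :: "nat \<Rightarrow> (nat \<Rightarrow> 'g \<Rightarrow> nat) \<Rightarrow> 'g set \<Rightarrow> nat set \<Rightarrow> nat \<Rightarrow> nat \<Rightarrow> real" where
  "moving_count n act T X y z = real (card {t \<in> moving n act T X. act y t = z})"

text \<open>The points \<open>k + 1\<close> and \<open>k + 2\<close> merely represent two distinct
  points outside \<open>{1..k}\<close>; \<open>count_outside\<close> shows that for
  \<open>k < m\<close> the choice does not affect the counts.\<close>

definition gap_value :: "nat \<Rightarrow> (nat \<Rightarrow> 'g \<Rightarrow> nat) \<Rightarrow> 'g set \<Rightarrow> nat \<Rightarrow> real" where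
  "gap_value n act T k = moving_count n act T {1..k} (k + 1) (k + 1) - moving_count n act T {1..k} (k + 2) (k + 1)"

lemma T_sub_eq_moving: "T_sub n act T k = moving n act T {1..k}"
  by (simp add: T_sub_def moving_def)

text \<open>The setting is made to survive passage to the stabilizer of \<open>n\<close>: there
  \<open>n\<close> and \<open>b\<close> drop by one, while \<open>m\<close> stays the same, being
  only an upper bound for the supports.\<close>

locale transitive_connection = right_action G "{1..n}" act
  for G (structure) and n :: nat and act +
  fixes T :: "'a set" and m b :: nat
  assumes fin: "finite (carrier G)"
    and T_carrier: "T \<subseteq> carrier G"
    and T_inv: "t \<in> T \<Longrightarrow> inv t \<in> T"
    and T_conj: "\<lbrakk>g \<in> carrier G; t \<in> T\<rbrakk> \<Longrightarrow> inv g \<otimes> t \<otimes> g \<in> T"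
    and supp_le: "t \<in> T \<Longrightarrow> card (supp {1..n} act t) \<le> m"
    and trans: "transitive_of_degree G {1..n} act (m + b)"
    and m_pos: "m \<ge> 1" and b_pos: "b \<ge> 1"
begin

abbreviation "moves \<equiv> moving n act T"
abbreviation "\<nu> \<equiv> moving_count n act T"

lemma n_ge: "n \<ge> m + b"
  using trans by (simp add: transitive_of_degree_def)

lemma finite_T: "finite T"
  using T_carrier fin finite_subset by blast

lemma finite_moves: "finite (moves X)"
  using finite_T by (simp add: moving_def)

lemma moves_carrier: "t \<in> moves X \<Longrightarrow> t \<in> carrier G"
  using T_carrier by (auto simp: moving_def)

lemma act_inv:
  assumes "x \<in> {1..n}" "g \<in> carrier G"
  shows "act (act x g) (inv g) = x" "act (act x (inv g)) g = x"
  using assms by (simp_all add: act_mult[symmetric] act_one del: atLeastAtMost_iff One_nat_def)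

lemma act_eq_iff:
  assumes "x \<in> {1..n}" "y \<in> {1..n}" "g \<in> carrier G"
  shows "act x g = act y g \<longleftrightarrow> x = y"
  using act_inv(1) assms by metis

lemma act_eq_iff_inv:
  assumes "x \<in> {1..n}" "y \<in> {1..n}" "g \<in> carrier G"
  shows "act x g = y \<longleftrightarrow> x = act y (inv g)"
  using act_inv assms by metis

lemma act_bij: "g \<in> carrier G \<Longrightarrow> bij_betw (\<lambda>x. act x g) {1..n} {1..n}"
  by (rule bij_betwI[where g = "\<lambda>x. act x (inv g)"])
    (use act_closed act_inv in \<open>auto simp del: atLeastAtMost_iff One_nat_def\<close>)

lemma act_conj:
  assumes "x \<in> {1..n}" "g \<in> carrier G" "t \<in> carrier G"
  shows "act (act x g) (inv g \<otimes> t \<otimes> g) = act (act x t) g"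
  using act_closed[OF assms(1,2)] act_inv(1)[OF assms(1,2)] assms
    act_mult[of "act x g" "inv g \<otimes> t" g] act_mult[of "act x g" "inv g" t] by simp

lemma moves_conj:
  assumes g: "g \<in> carrier G" and X: "X \<subseteq> {1..n}" and t: "t \<in> moves X"
  shows "inv g \<otimes> t \<otimes> g \<in> moves ((\<lambda>x. act x g) ` X)"
proof -
  have tc: "t \<in> carrier G" using moves_carrier[OF t] .
  have "act x g \<in> supp {1..n} act (inv g \<otimes> t \<otimes> g)" if x: "x \<in> X" for x
  proof -
    have xn: "x \<in> {1..n}" and "act x t \<noteq> x" using t x X by (auto simp: moving_def supp_def)
    then have "act (act x t) g \<noteq> act x g"
      using act_eq_iff[of "act x t" x g] act_closed[of x t] tc g by blast
    then show ?thesis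
      using act_closed[OF xn g] act_conj[OF xn g tc] by (simp add: supp_def)
  qed
  then show ?thesis using T_conj[OF g] t by (auto simp: moving_def)
qed

lemma moves_conj_bij:
  assumes g: "g \<in> carrier G" and X: "X \<subseteq> {1..n}"
  shows "bij_betw (\<lambda>t. inv g \<otimes> t \<otimes> g) (moves X) (moves ((\<lambda>x. act x g) ` X))"
proof (rule bij_betwI[where g = "\<lambda>t. g \<otimes> t \<otimes> inv g"])
  show "(\<lambda>t. inv g \<otimes> t \<otimes> g) \<in> moves X \<rightarrow> moves ((\<lambda>x. act x g) ` X)"
    using moves_conj[OF g X] by blast
  have "(\<lambda>x. act x g) ` X \<subseteq> {1..n}" using X g act_closed by blast
  from moves_conj[OF inv_closed[OF g] this]
  have "g \<otimes> t \<otimes> inv g \<in> moves ((\<lambda>x. act x (inv g)) ` (\<lambda>x. act x g) ` X)"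
    if "t \<in> moves ((\<lambda>x. act x g) ` X)" for t using that g by simp
  moreover have "(\<lambda>x. act x (inv g)) ` (\<lambda>x. act x g) ` X = X"
    unfolding image_image using X act_inv(1)[OF _ g] by force
  ultimately show "(\<lambda>t. g \<otimes> t \<otimes> inv g) \<in> moves ((\<lambda>x. act x g) ` X) \<rightarrow> moves X" by auto
qed (use g in \<open>auto dest!: moves_carrier simp: m_assoc\<close>, (simp add: m_assoc[symmetric])+)

text \<open>Conjugation by \<open>g\<close> relabels the points along \<open>g\<close>: if
  \<open>t\<close> sends \<open>y\<close> to \<open>z\<close>, the conjugate sends the image of
  \<open>y\<close> to the image of \<open>z\<close>.\<close>

lemma count_conj:
  assumes g: "g \<in> carrier G" and X: "X \<subseteq> {1..n}" and y: "y \<in> {1..n}" and z: "z \<in> {1..n}"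
  shows "\<nu> ((\<lambda>x. act x g) ` X) (act y g) (act z g) = \<nu> X y z"
proof -
  let ?c = "\<lambda>t. inv g \<otimes> t \<otimes> g"
  have iff: "act (act y g) (?c t) = act z g \<longleftrightarrow> act y t = z" if "t \<in> moves X" for t
    using act_conj[OF y g moves_carrier[OF that]]
      act_eq_iff[OF act_closed[OF y moves_carrier[OF that]] z g] by simp
  have "bij_betw ?c {t \<in> moves X. act y t = z}
      {t \<in> moves ((\<lambda>x. act x g) ` X). act (act y g) t = act z g}"
    using moves_conj_bij[OF g X] iff unfolding bij_betw_def inj_on_def by (auto 0 3 simp: image_iff)
  from bij_betw_same_card[OF this] show ?thesis by (simp add: moving_count_def)
qed

text \<open>Transitivity speaks about tuples of length exactly \<open>m + b\<close>. A shorter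
  partial injection is padded with points outside its domain and outside its image; there are enough
  of them because \<open>n \<ge> m + b\<close>.\<close>

lemma ex_map:
  assumes X: "X \<subseteq> {1..n}" "card X \<le> m + b" and inj: "inj_on \<sigma> X" and im: "\<sigma> ` X \<subseteq> {1..n}"
  shows "\<exists>g\<in>carrier G. \<forall>x\<in>X. act x g = \<sigma> x"
proof -
  have finX: "finite X" using X finite_subset by blast
  obtain xs where xs: "set xs = X" "distinct xs" using finite_distinct_list[OF finX] by blast
  obtain us where us: "set us = {1..n} - X" "distinct us"
    using finite_distinct_list[of "{1..n} - X"] by blast
  obtain vs where vs: "set vs = {1..n} - \<sigma> ` X" "distinct vs"
    using finite_distinct_list[of "{1..n} - \<sigma> ` X"] by blast
  define r where "r = m + b - card X"
  have lx: "length xs = card X" using xs distinct_card by metis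
  have "length us = n - card X" "length vs = n - card X"
    using us vs distinct_card[of us] distinct_card[of vs] X im finX inj
    by (simp_all add: card_Diff_subset card_image)
  then have r: "r \<le> length us" "r \<le> length vs" using n_ge by (simp_all add: r_def)
  let ?xs = "xs @ take r us" and ?ys = "map \<sigma> xs @ take r vs"
  have "length ?xs = m + b" "length ?ys = m + b" using r lx X by (simp_all add: r_def)
  moreover have "distinct ?xs" "distinct ?ys"
    using xs us vs inj set_take_subset[of r us] set_take_subset[of r vs]
    by (auto simp: distinct_map)
  moreover have "set ?xs \<subseteq> {1..n}" "set ?ys \<subseteq> {1..n}"
    using xs us vs X im set_take_subset[of r us] set_take_subset[of r vs] by auto
  ultimately obtain g where g: "g \<in> carrier G" "map (\<lambda>x. act x g) ?xs = ?ys"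
    using trans unfolding transitive_of_degree_def by blast
  then have "map (\<lambda>x. act x g) xs = map \<sigma> xs" by simp
  then show ?thesis using g(1) xs(1) by (auto simp: map_eq_conv)
qed

lemma ex_act:
  assumes "i \<in> {1..n}" "j \<in> {1..n}"
  shows "\<exists>g\<in>carrier G. act i g = j"
  using ex_map[of "{i}" "\<lambda>_. j"] assms m_pos by auto

lemma count_perm:
  assumes X: "X \<union> {y, z} \<subseteq> {1..n}" "card (X \<union> {y, z}) \<le> m + b"
    and inj: "inj_on \<sigma> (X \<union> {y, z})" and im: "\<sigma> ` (X \<union> {y, z}) \<subseteq> {1..n}"
  shows "\<nu> (\<sigma> ` X) (\<sigma> y) (\<sigma> z) = \<nu> X y z"
proof -
  obtain g where g: "g \<in> carrier G" "\<forall>x\<in>X \<union> {y, z}. act x g = \<sigma> x"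
    using ex_map[OF X inj im] by blast
  have "\<sigma> ` X = (\<lambda>x. act x g) ` X" by (intro image_cong refl) (use g in auto)
  then show ?thesis using count_conj[OF g(1), of X y z] g(2) X by simp
qed

lemma moves_inv: "t \<in> moves X \<Longrightarrow> inv t \<in> moves X"
proof -
  assume t: "t \<in> moves X"
  then have tc: "t \<in> carrier G" by (rule moves_carrier)
  have "supp {1..n} act t \<subseteq> supp {1..n} act (inv t)"
    using act_inv(2)[OF _ tc] by (auto simp: supp_def) (metis)
  then show ?thesis using t T_inv by (auto simp: moving_def)
qed

lemma count_sym:
  assumes "y \<in> {1..n}" "z \<in> {1..n}"
  shows "\<nu> X y z = \<nu> X z y"
proof -
  have "bij_betw (\<lambda>t. inv t) {t \<in> moves X. act y t = z} {t \<in> moves X. act z t = y}"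
    by (rule bij_betwI[where g = "\<lambda>t. inv t"])
      (use assms moves_inv act_inv in \<open>auto dest: moves_carrier simp del: atLeastAtMost_iff One_nat_def\<close>)
  from bij_betw_same_card[OF this] show ?thesis by (simp add: moving_count_def)
qed

lemma count_nonneg: "\<nu> X y z \<ge> 0"
  by (simp add: moving_count_def)

text \<open>Grouping the elements by the image of \<open>y\<close> turns a matrix-vector product
  into a sum over the connection set.\<close>

lemma sum_count:
  assumes "y \<in> {1..n}"
  shows "(\<Sum>z\<in>{1..n}. \<nu> X y z * f z) = (\<Sum>t\<in>moves X. f (act y t))"
proof -
  have "(\<Sum>t\<in>moves X. f (act y t)) = (\<Sum>z\<in>{1..n}. \<Sum>t\<in>{t \<in> moves X. act y t = z}. f (act y t))"
    by (rule sum.group[symmetric]) (use finite_moves act_closed[OF assms] moves_carrier in auto)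
  also have "\<dots> = (\<Sum>z\<in>{1..n}. \<nu> X y z * f z)"
    by (intro sum.cong refl) (simp add: moving_count_def)
  finally show ?thesis by simp
qed

lemma row_sum_count:
  assumes "y \<in> {1..n}"
  shows "(\<Sum>z\<in>{1..n}. \<nu> X y z) = card (moves X)"
  using sum_count[OF assms, of X "\<lambda>_. 1"] by simp

section \<open>The quotient matrices\<close>

text \<open>At most \<open>k + 2 \<le> m + 1 \<le> m + b\<close> points are involved, which is
  within the reach of the transitivity.\<close>

lemma count_permuted:
  assumes k: "k < m" and inj: "inj_on \<sigma> ({1..k} \<union> {y, z})" and im: "\<sigma> ` {1..k} = {1..k}"
    and "y \<in> {1..n}" "z \<in> {1..n}" "\<sigma> y \<in> {1..n}" "\<sigma> z \<in> {1..n}"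
  shows "\<nu> {1..k} (\<sigma> y) (\<sigma> z) = \<nu> {1..k} y z"
proof -
  have "k \<le> n" using k n_ge by linarith
  moreover have "card ({1..k} \<union> {y, z}) \<le> k + card {y, z}"
    using card_Un_le[of "{1..k}" "{y, z}"] by simp
  moreover have "card {y, z} \<le> 2" by (simp add: card_insert_if)
  ultimately show ?thesis
    using count_perm[of "{1..k}" y z \<sigma>] assms b_pos by (auto simp: image_Un)
qed

lemma count_swap:
  assumes k: "k < m" and st: "s \<in> {1..k} \<longleftrightarrow> t \<in> {1..k}"
    and "s \<in> {1..n}" "t \<in> {1..n}" "y \<in> {1..n}" "z \<in> {1..n}"
  shows "\<nu> {1..k} (transpose s t y) (transpose s t z) = \<nu> {1..k} y z"
proof (rule count_permuted[OF k])
  show "transpose s t ` {1..k} = {1..k}" using st by (rule transpose_image_eq)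
  show "inj_on (transpose s t) ({1..k} \<union> {y, z})" by (rule inj_on_transpose)
  show "transpose s t y \<in> {1..n}" "transpose s t z \<in> {1..n}"
    using assms(3-6) by (simp_all only: Transposition.transpose_def split: if_split) simp_all
qed (fact assms)+

lemma count_outside:
  assumes k: "k < m" and "s \<in> {k+1..n}" "t \<in> {k+1..n}" "s \<noteq> t"
  shows "\<nu> {1..k} s t = \<nu> {1..k} (k + 2) (k + 1)"
    and "\<nu> {1..k} s s = \<nu> {1..k} (k + 1) (k + 1)"
proof -
  \<comment> \<open>In general this is not a permutation of all points; injectivity on
    \<open>{1..k}\<close> together with \<open>s\<close> and \<open>t\<close> suffices.\<close>
  define \<sigma> where "\<sigma> x = (if x = s then k + 2 else if x = t then k + 1 else x)" for x
  have n: "k + 2 \<le> n" using n_ge k b_pos by linarith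
  have im: "\<sigma> ` {1..k} = {1..k}"
    using assms by (auto simp: \<sigma>_def image_iff)
  have "\<nu> {1..k} (\<sigma> s) (\<sigma> t) = \<nu> {1..k} s t"
    by (rule count_permuted[OF k _ im]) (use assms n in \<open>auto simp: \<sigma>_def inj_on_def\<close>)
  then show "\<nu> {1..k} s t = \<nu> {1..k} (k + 2) (k + 1)" using assms by (simp add: \<sigma>_def)
  show "\<nu> {1..k} s s = \<nu> {1..k} (k + 1) (k + 1)"
    using count_swap[OF k, of s "k + 1" s s] assms n by simp
qed

text \<open>Count all elements of \<open>moves {1..k}\<close> twice. Row \<open>k + 1\<close>,
  restricted to columns beyond \<open>k\<close>, accounts for \<open>?r + (n - k - 1) * ?q\<close>
  of them. On the other hand every element has support smaller than \<open>n\<close>, so it fixes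
  some point, necessarily outside \<open>{1..k}\<close>, whence there are at most
  \<open>(n - k) * ?r\<close>.\<close>

lemma count_outside_le_diag:
  assumes k: "k < m"
  shows "\<nu> {1..k} (k + 2) (k + 1) \<le> \<nu> {1..k} (k + 1) (k + 1)"
proof -
  let ?r = "\<nu> {1..k} (k + 1) (k + 1)" and ?q = "\<nu> {1..k} (k + 2) (k + 1)"
  have n: "k + 2 \<le> n" and mn: "m < n" using n_ge k b_pos by linarith+
  have "?r + real (n - k - 1) * ?q = (\<Sum>z\<in>{k+1..n}. \<nu> {1..k} (k + 1) z)"
  proof -
    have "{k+1..n} = insert (k + 1) {k+2..n}" using n by auto
    then have "(\<Sum>z\<in>{k+1..n}. \<nu> {1..k} (k + 1) z) = ?r + (\<Sum>z\<in>{k+2..n}. \<nu> {1..k} (k + 1) z)" by simp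
    also have "(\<Sum>z\<in>{k+2..n}. \<nu> {1..k} (k + 1) z) = (\<Sum>z\<in>{k+2..n}. ?q)"
      by (intro sum.cong refl count_outside(1)[OF k]) (use n in auto)
    finally show ?thesis by simp
  qed
  also have "\<dots> \<le> (\<Sum>z\<in>{1..n}. \<nu> {1..k} (k + 1) z)"
    by (intro sum_mono2) (auto simp: count_nonneg)
  also have "\<dots> = card (moves {1..k})"
    by (rule row_sum_count) (use n in auto)
  also have "\<dots> \<le> real (n - k) * ?r"
  proof -
    let ?F = "\<lambda>x. {t \<in> moves {1..k}. act x t = x}"
    have "moves {1..k} \<subseteq> (\<Union>x\<in>{k+1..n}. ?F x)"
    proof
      fix t assume t: "t \<in> moves {1..k}"
      then have "card (supp {1..n} act t) < card {1..n}"
        using supp_le[of t] mn by (simp add: moving_def)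
      moreover have "supp {1..n} act t \<subseteq> {1..n}" by (auto simp: supp_def)
      ultimately obtain x where x: "x \<in> {1..n}" "x \<notin> supp {1..n} act t"
        by (metis subsetI nat_less_le subset_antisym)
      then have "x \<notin> {1..k}" using t by (auto simp: moving_def)
      then show "t \<in> (\<Union>x\<in>{k+1..n}. ?F x)" using x t by (auto simp: supp_def)
    qed
    then have "card (moves {1..k}) \<le> card (\<Union>x\<in>{k+1..n}. ?F x)"
      by (intro card_mono) (auto simp: finite_moves)
    also have "\<dots> \<le> (\<Sum>x\<in>{k+1..n}. card (?F x))" by (rule card_UN_le) simp
    finally have "real (card (moves {1..k})) \<le> (\<Sum>x\<in>{k+1..n}. \<nu> {1..k} x x)"
      unfolding moving_count_def of_nat_sum[symmetric] by (rule of_nat_mono)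
    also have "\<dots> = (\<Sum>x\<in>{k+1..n}. ?r)"
    proof (intro sum.cong refl)
      fix x assume x: "x \<in> {k+1..n}"
      then show "\<nu> {1..k} x x = ?r"
        using count_outside(2)[OF k x, of "if x = k + 1 then k + 2 else k + 1"] n by auto
    qed
    finally show ?thesis by simp
  qed
  finally have le: "?r + real (n - k - 1) * ?q \<le> real (n - k) * ?r" .
  have "real (n - k) = real (n - k - 1) + 1" using n by simp
  then have "real (n - k - 1) * ?q \<le> real (n - k - 1) * ?r"
    using le by (simp only: distrib_right mult_1)
  moreover have "real (n - k - 1) > 0" using n by simp
  ultimately show ?thesis by (simp only: mult_le_cancel_left_pos)
qed

text \<open>An element of \<open>T\<close> mapping \<open>k + 2\<close> to \<open>k + 1\<close> also moves \<open>k + 1\<close>, so that exchanging the roles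
  of \<open>1\<close> and \<open>k + 1\<close> by conjugation keeps the set \<open>{1..k + 1}\<close> of moved points.\<close>

lemma count_outside_le_inside:
  assumes k: "k < m" "k \<ge> 1"
  shows "\<nu> {1..k} (k + 2) (k + 1) \<le> \<nu> {1..k} (k + 1) 1"
proof -
  have n: "k + 2 \<le> n" using n_ge k b_pos by linarith
  have "{t \<in> moves {1..k}. act (k + 2) t = k + 1} \<subseteq> {t \<in> moves {1..k+1}. act (k + 2) t = k + 1}"
  proof
    fix t assume t: "t \<in> {t \<in> moves {1..k}. act (k + 2) t = k + 1}"
    then have "act (k + 1) t \<noteq> k + 1"
      using act_eq_iff[of "k + 1" "k + 2" t] n moves_carrier[of t "{1..k}"] by auto
    then show "t \<in> {t \<in> moves {1..k+1}. act (k + 2) t = k + 1}"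
      using t n by (auto simp: moving_def supp_def subset_iff le_Suc_eq)
  qed
  then have "\<nu> {1..k} (k + 2) (k + 1) \<le> \<nu> {1..k+1} (k + 2) (k + 1)"
    unfolding moving_count_def by (intro of_nat_mono card_mono) (auto simp: finite_moves)
  also have "\<dots> = \<nu> {1..k+1} (k + 2) 1"
  proof -
    have "{1..k+1} \<union> {k+2, k+1} = {1..k+2}" by auto
    moreover have "transpose 1 (k+1) ` {1..k+1} = {1..k+1}" by (rule transpose_image_eq) auto
    moreover have "transpose 1 (k+1) ` {1..k+2} = {1..k+2}" by (rule transpose_image_eq) auto
    ultimately have "\<nu> {1..k+1} (transpose 1 (k+1) (k+2)) (transpose 1 (k+1) (k+1)) = \<nu> {1..k+1} (k+2) (k+1)"
      using count_perm[of "{1..k+1}" "k+2" "k+1" "transpose 1 (k+1)"] n k b_pos by simp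
    moreover have "transpose 1 (k+1) (k+2) = k+2" "transpose 1 (k+1) (k+1) = (1::nat)"
      by (simp_all add: Transposition.transpose_def)
    ultimately show ?thesis by simp
  qed
  also have "\<dots> \<le> \<nu> {1..k} (k + 2) 1"
  proof -
    have "{t \<in> moves {1..k+1}. act (k + 2) t = 1} \<subseteq> {t \<in> moves {1..k}. act (k + 2) t = 1}"
      by (auto simp: moving_def subset_iff)
    then show ?thesis
      unfolding moving_count_def by (intro of_nat_mono card_mono) (simp_all add: finite_moves)
  qed
  also have "\<dots> = \<nu> {1..k} (k + 1) 1"
  proof -
    have "transpose (k+2) (k+1) (k+2) = k+1" "transpose (k+2) (k+1) 1 = 1"
      using k by (simp_all add: Transposition.transpose_def)
    then show ?thesis using count_swap[OF k(1), of "k + 2" "k + 1" "k + 2" 1] n by simp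
  qed
  finally show ?thesis .
qed

text \<open>Subtract the eigenvalue equations at \<open>s\<close> and \<open>t\<close>. By the
  symmetry exchanging \<open>s\<close> and \<open>t\<close>, the two rows agree in every other
  column, so only a two-by-two block remains.\<close>

lemma quotient_eigenvalue_diff:
  assumes k: "k < m" and "s \<in> {1..n}" "t \<in> {1..n}" "s \<in> {1..k} \<longleftrightarrow> t \<in> {1..k}" "v s \<noteq> v t"
    and ev: "\<And>y. y \<in> {1..n} \<Longrightarrow> (\<Sum>z\<in>{1..n}. \<nu> {1..k} y z * v z) = \<theta> * v y"
  shows "\<theta> = \<nu> {1..k} s s - \<nu> {1..k} s t"
proof -
  let ?d = "\<lambda>z. (\<nu> {1..k} s z - \<nu> {1..k} t z) * v z"
  have ne: "s \<noteq> t" using assms by auto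
  have "\<theta> * (v s - v t) = (\<Sum>z\<in>{1..n}. ?d z)"
    using ev[of s] ev[of t] assms by (simp add: left_diff_distrib right_diff_distrib sum_subtractf)
  also have "\<dots> = (\<Sum>z\<in>{s, t}. ?d z)"
  proof (rule sum.mono_neutral_right)
    show "\<forall>z\<in>{1..n} - {s, t}. ?d z = 0"
    proof
      fix z assume z: "z \<in> {1..n} - {s, t}"
      then have "transpose s t z = z" by (auto simp: Transposition.transpose_def)
      moreover have "z \<in> {1..n}" using z by blast
      ultimately have "\<nu> {1..k} t z = \<nu> {1..k} s z"
        using count_swap[OF k assms(4,2,3), of s z] assms(2) by (simp only: transpose_apply_first)
      then show "?d z = 0" by simp
    qed
  qed (use assms in auto)
  also have "\<dots> = ?d s + ?d t" using ne by simp
  also have "\<nu> {1..k} t t = \<nu> {1..k} s s" using count_swap[OF k assms(4,2,3), of s s] assms by simp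
  also have "\<nu> {1..k} t s = \<nu> {1..k} s t" using count_sym assms by blast
  finally have "(\<theta> - (\<nu> {1..k} s s - \<nu> {1..k} s t)) * (v s - v t) = 0" by (simp add: algebra_simps)
  then show ?thesis using assms(5) by simp
qed

text \<open>If \<open>v\<close> is not constant on \<open>{k+1..n}\<close>, the eigenvalue is
  exactly the gap value. If it is not constant on \<open>{1..k}\<close>, the diagonal entry there is
  zero, so the eigenvalue is at most zero, and the gap value is nonnegative. If \<open>v\<close> is
  constant on both blocks, the vanishing total determines the ratio of the two constants and the
  eigenvalue is the gap value minus \<open>(n - k) * (?p - ?q)\<close>.\<close>

lemma quotient_eigenvalue_le:
  assumes k: "k < m"
    and sum0: "(\<Sum>z\<in>{1..n}. v z) = 0" and nz: "\<exists>z\<in>{1..n}. v z \<noteq> 0"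
    and ev: "\<And>y. y \<in> {1..n} \<Longrightarrow> (\<Sum>z\<in>{1..n}. \<nu> {1..k} y z * v z) = \<theta> * v y"
  shows "\<theta> \<le> gap_value n act T k"
proof -
  let ?r = "\<nu> {1..k} (k + 1) (k + 1)" and ?q = "\<nu> {1..k} (k + 2) (k + 1)"
  have n: "k + 2 \<le> n" using n_ge k b_pos by linarith
  have gap: "gap_value n act T k = ?r - ?q" by (simp add: gap_value_def)
  have split: "{1..n} = {1..k} \<union> {k+1..n}" "{1..k} \<inter> {k+1..n} = {}" using n by auto
  consider (outside) "\<exists>s\<in>{k+1..n}. \<exists>t\<in>{k+1..n}. v s \<noteq> v t"
    | (inside) "\<exists>s\<in>{1..k}. \<exists>t\<in>{1..k}. v s \<noteq> v t"
    | (const) "\<forall>s\<in>{k+1..n}. \<forall>t\<in>{k+1..n}. v s = v t" "\<forall>s\<in>{1..k}. \<forall>t\<in>{1..k}. v s = v t"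
    by blast
  then show ?thesis
  proof cases
    case outside
    then obtain s t where st: "s \<in> {k+1..n}" "t \<in> {k+1..n}" "v s \<noteq> v t" by blast
    then have "s \<noteq> t" by auto
    have "\<theta> = \<nu> {1..k} s s - \<nu> {1..k} s t"
      by (rule quotient_eigenvalue_diff[OF k]) (use st ev in auto)
    then show ?thesis using count_outside[OF k st(1,2) \<open>s \<noteq> t\<close>] gap by linarith
  next
    case inside
    then obtain s t where st: "s \<in> {1..k}" "t \<in> {1..k}" "v s \<noteq> v t" by blast
    have "\<theta> = \<nu> {1..k} s s - \<nu> {1..k} s t"
      by (rule quotient_eigenvalue_diff[OF k]) (use st ev n in auto)
    moreover have "{t \<in> moves {1..k}. act s t = s} = {}"
      using st(1) by (auto simp: moving_def supp_def)
    then have "\<nu> {1..k} s s = 0" unfolding moving_count_def by (simp only: card.empty of_nat_0)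
    ultimately show ?thesis using count_nonneg[of "{1..k}" s t] count_outside_le_diag[OF k] gap by linarith
  next
    case const
    define \<alpha> \<beta> where "\<alpha> = v 1" and "\<beta> = v (k + 1)"
    have va: "v z = \<alpha>" if "z \<in> {1..k}" for z
    proof -
      have "1 \<in> {1..k}" using that by auto
      then show ?thesis using const(2) that unfolding \<alpha>_def by blast
    qed
    have vb: "v z = \<beta>" if "z \<in> {k+1..n}" for z
    proof -
      have "k + 1 \<in> {k+1..n}" using n by simp
      then show ?thesis using const(1) that unfolding \<beta>_def by blast
    qed
    have inside: "(\<Sum>z\<in>{1..k}. g z * v z) = (\<Sum>z\<in>{1..k}. g z) * \<alpha>"
      and outside: "(\<Sum>z\<in>{k+1..n}. g z * v z) = (\<Sum>z\<in>{k+1..n}. g z) * \<beta>" for g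
      unfolding sum_distrib_right by (intro sum.cong refl, simp only: va vb)+
    have total: "real k * \<alpha> + real (n - k) * \<beta> = 0"
      using sum0 inside[of "\<lambda>_. 1"] outside[of "\<lambda>_. 1"] sum.union_disjoint[of "{1..k}" "{k+1..n}" v] split
      by (simp del: One_nat_def)
    \<comment> \<open>If the outer constant were zero, the vanishing total would make the inner one
      zero too, or the inner block empty.\<close>
    have \<beta>: "\<beta> \<noteq> 0"
    proof
      assume b0: "\<beta> = 0"
      then have "k = 0 \<or> \<alpha> = 0" using total by simp
      then have "v z = 0" if "z \<in> {1..n}" for z
        using that b0 split va[of z] vb[of z] by (cases "z \<in> {1..k}") auto
      then show False using nz by blast
    qed
    then have kpos: "k \<ge> 1" using total n by (cases k) auto
    let ?p = "\<nu> {1..k} (k + 1) 1"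
    have "(\<Sum>z\<in>{1..k}. \<nu> {1..k} (k + 1) z) = (\<Sum>z\<in>{1..k}. ?p)"
    proof (intro sum.cong refl)
      fix z assume z: "z \<in> {1..k}"
      have "transpose 1 z (k + 1) = k + 1" "transpose 1 z 1 = z"
        using z kpos by (auto simp: Transposition.transpose_def)
      then show "\<nu> {1..k} (k + 1) z = ?p"
        using count_swap[OF k, of 1 z "k + 1" 1] z n kpos by auto
    qed
    then have sum_in: "(\<Sum>z\<in>{1..k}. \<nu> {1..k} (k + 1) z) = real k * ?p" by simp
    have sum_out: "(\<Sum>z\<in>{k+1..n}. \<nu> {1..k} (k + 1) z) = ?r + real (n - k - 1) * ?q"
    proof -
      have "{k+1..n} = insert (k + 1) {k+2..n}" using n by auto
      then have "(\<Sum>z\<in>{k+1..n}. \<nu> {1..k} (k + 1) z) = ?r + (\<Sum>z\<in>{k+2..n}. \<nu> {1..k} (k + 1) z)" by simp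
      also have "(\<Sum>z\<in>{k+2..n}. \<nu> {1..k} (k + 1) z) = (\<Sum>z\<in>{k+2..n}. ?q)"
        by (intro sum.cong refl count_outside(1)[OF k]) (use n in auto)
      finally show ?thesis by simp
    qed
    have "(\<Sum>z\<in>{1..n}. \<nu> {1..k} (k + 1) z * v z)
        = (\<Sum>z\<in>{1..k}. \<nu> {1..k} (k + 1) z) * \<alpha> + (\<Sum>z\<in>{k+1..n}. \<nu> {1..k} (k + 1) z) * \<beta>"
      using inside[of "\<nu> {1..k} (k + 1)"] outside[of "\<nu> {1..k} (k + 1)"] split
        sum.union_disjoint[of "{1..k}" "{k+1..n}" "\<lambda>z. \<nu> {1..k} (k + 1) z * v z"]
      by (simp del: One_nat_def)
    moreover have "k + 1 \<in> {1..n}" using n by simp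
    \<comment> \<open>This is the eigenvalue equation at \<open>k + 1\<close>; below, the inner
      constant is eliminated by means of \<open>total\<close>.\<close>
    ultimately have "\<theta> * \<beta> = real k * ?p * \<alpha> + (?r + real (n - k - 1) * ?q) * \<beta>"
      using ev[of "k + 1"] unfolding sum_in sum_out \<beta>_def by simp
    also have "real k * ?p * \<alpha> = ?p * (real k * \<alpha>)" by simp
    also have "real k * \<alpha> = - real (n - k) * \<beta>" using total by linarith
    also have "real (n - k) = real (n - k - 1) + 1" using n by simp
    finally have "\<theta> * \<beta> = (?r - ?q - (real (n - k - 1) + 1) * (?p - ?q)) * \<beta>" by (simp add: algebra_simps)
    then have "\<theta> = ?r - ?q - (real (n - k - 1) + 1) * (?p - ?q)" using \<beta> by simp
    moreover have "(real (n - k - 1) + 1) * (?p - ?q) \<ge> 0"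
      using count_outside_le_inside[OF k kpos] by simp
    ultimately show ?thesis using gap by linarith
  qed
qed

text \<open>\<open>B_Pi\<close> has the source point in the column index, hence the exchanged
  arguments of \<open>\<nu>\<close>; the list starting at 1 absorbs the shift between indices and
  points.\<close>

lemma B_Pi_eq_weight_mat:
  "B_Pi G n act T k 0 = weight_mat (\<lambda>y z. \<nu> {1..k} z y) [1..<n+1]"
proof -
  have "tail_stabilizer G n act 0 = carrier G"
    by (simp add: tail_stabilizer_def pointwise_stabilizer_def)
  moreover have "{t \<in> moves X. act y t = z} = moves X \<inter> carrier G \<inter> transporter G act y z" for X y z
    using moves_carrier by (auto simp: transporter_def)
  ultimately show ?thesis
    unfolding B_Pi_def weight_mat_def T_sub_eq_moving moving_count_def
    by (intro eq_matI) (auto simp del: upt_Suc)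
qed

lemma B_Pi_lambda2_variational:
  defines "\<theta> k \<equiv> mat_lambda2 (B_Pi G n act T k 0)"
  shows "(\<Sum>x\<in>{1..n}. f x) = 0 \<Longrightarrow>
      (\<Sum>x\<in>{1..n}. f x * (\<Sum>y\<in>{1..n}. \<nu> {1..k} x y * f y)) \<le> \<theta> k * (\<Sum>x\<in>{1..n}. f x * f x)"
    and "\<exists>f. (\<Sum>x\<in>{1..n}. f x) = 0 \<and> (\<exists>x\<in>{1..n}. f x \<noteq> 0) \<and>
      (\<forall>x\<in>{1..n}. (\<Sum>y\<in>{1..n}. \<nu> {1..k} x y * f y) = \<theta> k * f x)"
proof -
  have vs: "distinct [1..<n+1]" "set [1..<n+1] = {1..n}" by auto
  have card: "card {1..n} \<ge> 2" using n_ge m_pos b_pos by simp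
  have row: "(\<Sum>z\<in>{1..n}. \<nu> {1..k} z y) = card (moves {1..k})" if "y \<in> {1..n}" for y
  proof -
    have "(\<Sum>z\<in>{1..n}. \<nu> {1..k} z y) = (\<Sum>z\<in>{1..n}. \<nu> {1..k} y z)"
      using that count_sym by (intro sum.cong) auto
    then show ?thesis using row_sum_count[OF that] by simp
  qed
  have eq: "(\<Sum>y\<in>{1..n}. \<nu> {1..k} y x * f y) = (\<Sum>y\<in>{1..n}. \<nu> {1..k} x y * f y)" if "x \<in> {1..n}" for x f
    using that count_sym by (intro sum.cong) auto
  note main = weight_mat_lambda2[OF vs card, of "\<lambda>y z. \<nu> {1..k} z y" "real (card (moves {1..k}))",
      OF count_sym count_nonneg row, folded B_Pi_eq_weight_mat]
  show "(\<Sum>x\<in>{1..n}. f x) = 0 \<Longrightarrow>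
      (\<Sum>x\<in>{1..n}. f x * (\<Sum>y\<in>{1..n}. \<nu> {1..k} x y * f y)) \<le> \<theta> k * (\<Sum>x\<in>{1..n}. f x * f x)"
    using main(1)[of f] eq by (simp add: \<theta>_def del: One_nat_def)
  show "\<exists>f. (\<Sum>x\<in>{1..n}. f x) = 0 \<and> (\<exists>x\<in>{1..n}. f x \<noteq> 0) \<and>
      (\<forall>x\<in>{1..n}. (\<Sum>y\<in>{1..n}. \<nu> {1..k} x y * f y) = \<theta> k * f x)"
    using main(2) eq by (simp add: \<theta>_def del: One_nat_def)
qed

text \<open>The upper bound applies \<open>quotient_eigenvalue_le\<close> to an eigenvector with
  coordinate sum zero; the lower bound evaluates the form at a test vector.\<close>

lemma B_Pi_lambda2:
  assumes k: "k < m"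
  shows "mat_lambda2 (B_Pi G n act T k 0) = gap_value n act T k"
proof (rule antisym)
  show "mat_lambda2 (B_Pi G n act T k 0) \<le> gap_value n act T k"
    using B_Pi_lambda2_variational(2)[of k] quotient_eigenvalue_le[OF k] by blast
next
  have n: "k + 2 \<le> n" using n_ge k b_pos by linarith
  \<comment> \<open>The difference of the unit vectors at \<open>k + 1\<close> and
    \<open>k + 2\<close> has squared norm 2 and form value twice the gap.\<close>
  define f :: "nat \<Rightarrow> real" where "f x = (if x = k + 1 then 1 else if x = k + 2 then -1 else 0)" for x
  have f: "(\<Sum>x\<in>{1..n}. f x * g x) = g (k + 1) - g (k + 2)" for g
  proof -
    have "(\<Sum>x\<in>{1..n}. f x * g x) = (\<Sum>x\<in>{k + 1, k + 2}. f x * g x)"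
      by (rule sum.mono_neutral_right) (use n in \<open>auto simp: f_def\<close>)
    then show ?thesis by (simp add: f_def)
  qed
  have "(\<Sum>y\<in>{1..n}. \<nu> {1..k} x y * f y) = \<nu> {1..k} x (k + 1) - \<nu> {1..k} x (k + 2)" for x
    using f[of "\<nu> {1..k} x"] by (simp add: mult.commute)
  moreover have "\<nu> {1..k} (k + 1) (k + 2) = \<nu> {1..k} (k + 2) (k + 1)"
    "\<nu> {1..k} (k + 2) (k + 2) = \<nu> {1..k} (k + 1) (k + 1)"
    using count_sym[of "k + 1" "k + 2" "{1..k}"] count_outside(2)[OF k, of "k + 2" "k + 1"] n by auto
  ultimately have "(\<Sum>x\<in>{1..n}. f x * (\<Sum>y\<in>{1..n}. \<nu> {1..k} x y * f y)) = 2 * gap_value n act T k"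
    unfolding f by (simp add: gap_value_def)
  moreover have "(\<Sum>x\<in>{1..n}. f x * f x) = 2" unfolding f by (simp add: f_def)
  moreover have "(\<Sum>x\<in>{1..n}. f x) = 0" using f[of "\<lambda>_. 1"] by simp
  ultimately show "gap_value n act T k \<le> mat_lambda2 (B_Pi G n act T k 0)"
    using B_Pi_lambda2_variational(1)[of f k] by simp
qed

section \<open>Passing from a point stabilizer to the group\<close>

abbreviation "N \<equiv> point_stabilizer G act n"

lemma sum_moves_inv: "(\<Sum>t\<in>moves X. F (inv t)) = (\<Sum>t\<in>moves X. F t)"
  by (rule sum.reindex_bij_witness[of _ "\<lambda>t. inv t" "\<lambda>t. inv t"]) (auto simp: moves_inv dest: moves_carrier)

lemma sum_carrier_inv: "(\<Sum>x\<in>carrier G. F (inv x)) = (\<Sum>x\<in>carrier G. F x)"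
  by (rule sum.reindex_bij_witness[of _ "\<lambda>t. inv t" "\<lambda>t. inv t"]) auto

lemma card_carrier: "card (carrier G) \<ge> 2"
proof -
  have "1 \<in> {1..n}" "2 \<in> {1..n}" using n_ge m_pos b_pos by auto
  then obtain g where g: "g \<in> carrier G" "act 1 g = 2" using ex_act by blast
  then have "g \<noteq> \<one>" using act_one[of 1] \<open>1 \<in> {1..n}\<close> by auto
  then have "card {g, \<one>} = 2" by simp
  moreover have "card {g, \<one>} \<le> card (carrier G)" using g fin by (intro card_mono) auto
  ultimately show ?thesis by simp
qed

lemmas graph_lambda2_variational =
  Cay_lambda2[OF fin card_carrier, of "moves X" for X, OF _ moves_inv]

text \<open>By transitivity the sum does not depend on \<open>i\<close>. Adding over all
  \<open>i\<close> and exchanging the sums gives, for each \<open>x\<close>, a rearrangement of the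
  total of \<open>\<phi>\<close>, which is zero.\<close>

lemma sum_orbit_eq_0:
  fixes \<phi> :: "nat \<Rightarrow> real"
  assumes "(\<Sum>z\<in>{1..n}. \<phi> z) = 0" and i: "i \<in> {1..n}"
  shows "(\<Sum>x\<in>carrier G. \<phi> (act i x)) = 0"
proof -
  have eq: "(\<Sum>x\<in>carrier G. \<phi> (act j x)) = (\<Sum>x\<in>carrier G. \<phi> (act i x))" if j: "j \<in> {1..n}" for j
  proof -
    obtain g where g: "g \<in> carrier G" "act i g = j" using ex_act[OF i j] by blast
    have "(\<Sum>x\<in>carrier G. \<phi> (act j x)) = (\<Sum>x\<in>carrier G. \<phi> (act i (g \<otimes> x)))"
      by (intro sum.cong refl) (use g(2) act_mult[OF i g(1)] in simp)
    then show ?thesis using sum_mult_left[OF g(1), of "\<lambda>x. \<phi> (act i x)"] by simp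
  qed
  have "real n * (\<Sum>x\<in>carrier G. \<phi> (act i x)) = (\<Sum>j\<in>{1..n}. \<Sum>x\<in>carrier G. \<phi> (act j x))"
    using eq by simp
  also have "\<dots> = (\<Sum>x\<in>carrier G. \<Sum>j\<in>{1..n}. \<phi> (act j x))" by (rule sum.swap)
  also have "\<dots> = (\<Sum>x\<in>carrier G. 0)"
    by (intro sum.cong refl) (use sum.reindex_bij_betw[OF act_bij, of _ \<phi>] assms(1) in simp)
  finally show ?thesis using i by simp
qed

text \<open>An eigenvector of the quotient matrix lifts to an eigenfunction on the group with the
  same eigenvalue and sum zero.\<close>

lemma gap_le_graph_lambda2:
  assumes k: "k < m"
  shows "gap_value n act T k \<le> graph_lambda2 (Cay G (moves {1..k}))"
proof -
  let ?\<mu> = "gap_value n act T k"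
  obtain \<phi> where \<phi>: "(\<Sum>z\<in>{1..n}. \<phi> z) = 0" "\<exists>z\<in>{1..n}. \<phi> z \<noteq> 0"
    "\<And>y. y \<in> {1..n} \<Longrightarrow> (\<Sum>z\<in>{1..n}. \<nu> {1..k} y z * \<phi> z) = ?\<mu> * \<phi> y"
    using B_Pi_lambda2_variational(2)[of k] unfolding B_Pi_lambda2[OF k] by blast
  have one: "1 \<in> {1..n}" using n_ge m_pos by simp
  \<comment> \<open>The inverse reconciles left multiplication with the right action: multiplying
    \<open>x\<close> by \<open>t\<close> on the left applies \<open>inv t\<close> to the point
    \<open>act 1 (inv x)\<close>, and the connection set is closed under inverses.\<close>
  define f where "f x = \<phi> (act 1 (inv x))" for x
  have Af: "(\<Sum>t\<in>moves {1..k}. f (t \<otimes> x)) = ?\<mu> * f x" if x: "x \<in> carrier G" for x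
  proof -
    have y: "act 1 (inv x) \<in> {1..n}" using act_closed[OF one] x by simp
    have "(\<Sum>t\<in>moves {1..k}. f (t \<otimes> x)) = (\<Sum>t\<in>moves {1..k}. \<phi> (act (act 1 (inv x)) (inv t)))"
      unfolding f_def
      by (intro sum.cong refl) (use x act_mult[OF one] moves_carrier in \<open>simp add: inv_mult_group\<close>)
    also have "\<dots> = (\<Sum>t\<in>moves {1..k}. \<phi> (act (act 1 (inv x)) t))"
      by (rule sum_moves_inv)
    also have "\<dots> = (\<Sum>z\<in>{1..n}. \<nu> {1..k} (act 1 (inv x)) z * \<phi> z)"
      by (rule sum_count[OF y, symmetric])
    finally show ?thesis using \<phi>(3)[OF y] by (simp add: f_def)
  qed
  have "(\<Sum>x\<in>carrier G. f x) = 0"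
    unfolding f_def using sum_carrier_inv[of "\<lambda>x. \<phi> (act 1 x)"] sum_orbit_eq_0[OF \<phi>(1) one] by simp
  then have "(\<Sum>x\<in>carrier G. f x * (\<Sum>t\<in>moves {1..k}. f (t \<otimes> x)))
      \<le> graph_lambda2 (Cay G (moves {1..k})) * (\<Sum>x\<in>carrier G. f x * f x)"
    using graph_lambda2_variational(1) moves_carrier by blast
  moreover have "(\<Sum>x\<in>carrier G. f x * (\<Sum>t\<in>moves {1..k}. f (t \<otimes> x)))
      = ?\<mu> * (\<Sum>x\<in>carrier G. f x * f x)"
    using Af by (simp add: sum_distrib_left ac_simps)
  moreover have "(\<Sum>x\<in>carrier G. f x * f x) > 0"
  proof -
    obtain j where j: "j \<in> {1..n}" "\<phi> j \<noteq> 0" using \<phi>(2) by blast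
    obtain g where g: "g \<in> carrier G" "act 1 g = j" using ex_act[OF one j(1)] by blast
    then have "f (inv g) \<noteq> 0" using j by (simp add: f_def)
    then have "f (inv g) * f (inv g) > 0" using zero_less_mult_iff[of "f (inv g)" "f (inv g)"] by linarith
    then show ?thesis using g by (intro sum_pos2[OF fin, of "inv g"]) auto
  qed
  ultimately show ?thesis by simp
qed

text \<open>An element sends \<open>y\<close> to \<open>i\<close> exactly when its left multiple by
  \<open>t\<close> sends the preimage of \<open>y\<close> under \<open>t\<close> to
  \<open>i\<close>.\<close>

lemma sum_transporter:
  assumes t: "t \<in> carrier G" and y: "y \<in> {1..n}"
  shows "(\<Sum>x\<in>transporter G act y i. f (t \<otimes> x)) = (\<Sum>x\<in>transporter G act (act y (inv t)) i. f x)"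
proof (rule sum.reindex_bij_witness[of _ "\<lambda>x. inv t \<otimes> x" "\<lambda>x. t \<otimes> x"])
  have c: "act y (inv t) \<in> {1..n}" using act_closed y t by blast
  show "t \<otimes> x \<in> transporter G act (act y (inv t)) i" if "x \<in> transporter G act y i" for x
    using that act_mult[OF c t] act_inv(2)[OF y t] t by (simp add: transporter_def)
  show "inv t \<otimes> x \<in> transporter G act y i" if "x \<in> transporter G act (act y (inv t)) i" for x
    using that act_mult[OF y] t by (simp add: transporter_def)
qed (use t in \<open>auto simp: transporter_def m_assoc[symmetric]\<close>)

lemma sum_over_transporters:
  assumes "i \<in> {1..n}"
  shows "(\<Sum>j\<in>{1..n}. \<Sum>x\<in>transporter G act j i. f x) = (\<Sum>x\<in>carrier G. f x)"
    and "(\<Sum>j\<in>{1..n}. \<Sum>x\<in>transporter G act i j. f x) = (\<Sum>x\<in>carrier G. f x)"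
proof -
  have "act j x = i \<longleftrightarrow> act i (inv x) = j" if "j \<in> {1..n}" "x \<in> carrier G" for j x
    using act_eq_iff_inv[OF that(1) assms that(2)] by metis
  then have "transporter G act j i = {x \<in> carrier G. act i (inv x) = j}" if "j \<in> {1..n}" for j
    using that unfolding transporter_def by blast
  moreover have "(\<Sum>j\<in>{1..n}. \<Sum>x\<in>{x \<in> carrier G. act i (inv x) = j}. f x) = (\<Sum>x\<in>carrier G. f x)"
    by (rule sum.group) (use fin act_closed[OF assms] in auto)
  ultimately show "(\<Sum>j\<in>{1..n}. \<Sum>x\<in>transporter G act j i. f x) = (\<Sum>x\<in>carrier G. f x)" by simp
  show "(\<Sum>j\<in>{1..n}. \<Sum>x\<in>transporter G act i j. f x) = (\<Sum>x\<in>carrier G. f x)"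
    unfolding transporter_def by (rule sum.group) (use fin act_closed[OF assms] in auto)
qed

definition orthogonal_to_transporters :: "('a \<Rightarrow> real) \<Rightarrow> bool" where
  "orthogonal_to_transporters f \<longleftrightarrow>
     (\<forall>i\<in>{1..n}. \<forall>j\<in>{1..n}. (\<Sum>x\<in>transporter G act j i. f x) = 0)"

text \<open>Only eigenfunctions orthogonal to all transporters need the assumed bound; the others
  are controlled by the quotient matrix.\<close>

lemma graph_lambda2_le_gap:
  assumes k: "k < m"
    and orth: "\<And>f. orthogonal_to_transporters f \<Longrightarrow>
      (\<Sum>x\<in>carrier G. f x * (\<Sum>t\<in>moves {1..k}. f (t \<otimes> x)))
        \<le> gap_value n act T k * (\<Sum>x\<in>carrier G. f x * f x)"
  shows "graph_lambda2 (Cay G (moves {1..k})) \<le> gap_value n act T k"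
proof -
  let ?\<theta> = "graph_lambda2 (Cay G (moves {1..k}))"
  have "moves {1..k} \<subseteq> carrier G" using moves_carrier by blast
  then obtain f where f: "(\<Sum>x\<in>carrier G. f x) = 0" "\<exists>x\<in>carrier G. f x \<noteq> 0"
    "\<And>x. x \<in> carrier G \<Longrightarrow> (\<Sum>t\<in>moves {1..k}. f (t \<otimes> x)) = ?\<theta> * f x"
    using graph_lambda2_variational(2)[of "{1..k}"] by auto
  show ?thesis
  proof (cases "orthogonal_to_transporters f")
    case True
    have "?\<theta> * (\<Sum>x\<in>carrier G. f x * f x) \<le> gap_value n act T k * (\<Sum>x\<in>carrier G. f x * f x)"
    proof -
      have "(\<Sum>x\<in>carrier G. f x * (\<Sum>t\<in>moves {1..k}. f (t \<otimes> x))) = (\<Sum>x\<in>carrier G. f x * (?\<theta> * f x))"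
        by (intro sum.cong refl arg_cong2[of _ _ _ _ times] f(3))
      also have "\<dots> = ?\<theta> * (\<Sum>x\<in>carrier G. f x * f x)"
        unfolding sum_distrib_left by (intro sum.cong refl) simp
      finally show ?thesis using orth[OF True] by linarith
    qed
    moreover have "(\<Sum>x\<in>carrier G. f x * f x) > 0"
    proof -
      obtain g where g: "g \<in> carrier G" "f g \<noteq> 0" using f(2) by blast
      then have "f g * f g > 0" using zero_less_mult_iff[of "f g" "f g"] by linarith
      then show ?thesis using g by (intro sum_pos2[OF fin, of g]) auto
    qed
    ultimately show ?thesis by simp
  next
    case False
    then obtain i j where i: "i \<in> {1..n}" and j: "j \<in> {1..n}" "(\<Sum>x\<in>transporter G act j i. f x) \<noteq> 0"
      unfolding orthogonal_to_transporters_def by blast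
    \<comment> \<open>With the target \<open>i\<close> fixed, left multiplication permutes the
      transporters by their source point, so these block sums form an eigenvector of the quotient
      matrix; it is nonzero at \<open>j\<close>.\<close>
    define v where "v y = (\<Sum>x\<in>transporter G act y i. f x)" for y
    show ?thesis
    proof (rule quotient_eigenvalue_le[OF k, of v])
      show "(\<Sum>z\<in>{1..n}. v z) = 0"
        unfolding v_def sum_over_transporters(1)[OF i] by (rule f(1))
      show "\<exists>z\<in>{1..n}. v z \<noteq> 0" using j by (auto simp: v_def)
      fix y assume y: "y \<in> {1..n}"
      have "?\<theta> * v y = (\<Sum>x\<in>transporter G act y i. \<Sum>t\<in>moves {1..k}. f (t \<otimes> x))"
        unfolding v_def sum_distrib_left
        by (intro sum.cong refl f(3)[symmetric]) (simp add: transporter_def)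
      also have "\<dots> = (\<Sum>t\<in>moves {1..k}. \<Sum>x\<in>transporter G act y i. f (t \<otimes> x))"
        by (rule sum.swap)
      also have "\<dots> = (\<Sum>t\<in>moves {1..k}. v (act y (inv t)))"
        unfolding v_def by (intro sum.cong refl sum_transporter) (use y moves_carrier in auto)
      also have "\<dots> = (\<Sum>t\<in>moves {1..k}. v (act y t))"
        by (rule sum_moves_inv)
      finally show "(\<Sum>z\<in>{1..n}. \<nu> {1..k} y z * v z) = ?\<theta> * v y"
        using sum_count[OF y] by simp
    qed
  qed
qed

section \<open>Splitting the connection set by whether the last point is fixed\<close>

lemma N_iff: "g \<in> N \<longleftrightarrow> g \<in> carrier G \<and> act n g = n"
  by (auto simp: point_stabilizer_def transporter_def)

lemma n_mem: "n \<in> {1..n}"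
  using n_ge m_pos by simp

lemma N_subgroup: "subgroup N G"
proof (rule subgroupI)
  show "N \<noteq> {}" using N_iff act_one[OF n_mem] by blast
  show "inv g \<in> N" if "g \<in> N" for g
    using that act_inv(1)[OF n_mem, of g] by (auto simp: N_iff)
qed (auto simp: N_iff act_mult[OF n_mem])

lemma moving_N: "k < n \<Longrightarrow> moving (n - 1) act (T \<inter> N) {1..k} = {t \<in> moves {1..k}. act n t = n}"
  using T_carrier by (auto simp: moving_def supp_def N_iff subset_iff)

lemma moves_split:
  assumes "k < n"
  shows "moves {1..k} = moving (n - 1) act (T \<inter> N) {1..k} \<union> moves (insert n {1..k})"
    and "moving (n - 1) act (T \<inter> N) {1..k} \<inter> moves (insert n {1..k}) = {}"
  unfolding moving_N[OF assms] using n_mem by (auto simp: moving_def supp_def)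

lemma count_split:
  assumes "k < n"
  shows "\<nu> {1..k} y z = moving_count (n - 1) act (T \<inter> N) {1..k} y z + \<nu> (insert n {1..k}) y z"
proof -
  let ?A = "moving (n - 1) act (T \<inter> N) {1..k}" and ?B = "moves (insert n {1..k})"
  have "{t \<in> moves {1..k}. act y t = z} = {t \<in> ?A. act y t = z} \<union> {t \<in> ?B. act y t = z}"
    using moves_split(1)[OF assms] by auto
  moreover have "finite ?A" using finite_moves moves_split(1)[OF assms] by (metis finite_Un)
  moreover have "{t \<in> ?A. act y t = z} \<inter> {t \<in> ?B. act y t = z} = {}"
    using moves_split(2)[OF assms] by blast
  ultimately show ?thesis
    using card_Un_disjoint[of "{t \<in> ?A. act y t = z}" "{t \<in> ?B. act y t = z}"] finite_moves
    by (simp add: moving_count_def)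
qed

text \<open>Each count splits into elements fixing \<open>n\<close> and elements moving
  \<open>n\<close>. The latter are counted by \<open>insert n {1..k}\<close>, which a suitable
  conjugation turns into \<open>{1..k+1}\<close>. Up to \<open>k + 3\<close> points are involved,
  which is where \<open>b \<ge> 2\<close> enters.\<close>

lemma gap_value_split:
  assumes k: "k < m" and b: "b \<ge> 2"
  shows "gap_value n act T k = gap_value (n - 1) act (T \<inter> N) k + gap_value n act T (k + 1)"
proof -
  have n: "k + 3 \<le> n" using n_ge k b by linarith
  \<comment> \<open>\<open>n\<close> fills the new place \<open>k + 1\<close> of the moved set, and
    the two reference points shift up by one, matching the points used in the gap value at
    \<open>k + 1\<close>.\<close>
  define \<sigma> where "\<sigma> x = (if x = n then k + 1 else if x = k + 1 then k + 2
    else if x = k + 2 then k + 3 else x)" for x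
  have \<sigma>: "\<sigma> (k + 1) = k + 2" "\<sigma> (k + 2) = k + 3" using n by (simp_all add: \<sigma>_def)
  have "\<sigma> ` {1..k} = (\<lambda>x. x) ` {1..k}"
    by (intro image_cong refl) (use n in \<open>auto simp: \<sigma>_def\<close>)
  then have "\<sigma> ` insert n {1..k} = insert (\<sigma> n) {1..k}" by (simp only: image_insert image_ident)
  also have "\<dots> = {1..k+1}" by (auto simp: \<sigma>_def)
  finally have im: "\<sigma> ` insert n {1..k} = {1..k+1}" .
  have "\<nu> {1..k+1} (\<sigma> y) (\<sigma> (k + 1)) = \<nu> (insert n {1..k}) y (k + 1)"
    if y: "y \<in> {k + 1, k + 2}" for y
    unfolding im[symmetric]
  proof (rule count_perm)
    show "insert n {1..k} \<union> {y, k + 1} \<subseteq> {1..n}" using n y by auto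
    have "card (insert n {1..k} \<union> {y, k + 1}) \<le> card (insert n {1..k}) + card {y, k + 1}"
      by (rule card_Un_le)
    also have "\<dots> \<le> (k + 1) + 2"
      by (intro add_mono) (auto simp: card_insert_if)
    finally show "card (insert n {1..k} \<union> {y, k + 1}) \<le> m + b" using k b by linarith
    show "inj_on \<sigma> (insert n {1..k} \<union> {y, k + 1})"
      using n y by (auto simp: inj_on_def \<sigma>_def)
    show "\<sigma> ` (insert n {1..k} \<union> {y, k + 1}) \<subseteq> {1..n}"
      using n y by (auto simp: \<sigma>_def)
  qed
  from this[of "k + 1"] this[of "k + 2"]
  have "\<nu> (insert n {1..k}) (k + 1) (k + 1) = \<nu> {1..k+1} (k + 1 + 1) (k + 1 + 1)"
    "\<nu> (insert n {1..k}) (k + 2) (k + 1) = \<nu> {1..k+1} (k + 1 + 2) (k + 1 + 1)"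
    unfolding \<sigma> by (simp_all add: numeral_eq_Suc)
  moreover have "k < n" using n by simp
  ultimately show ?thesis
    unfolding gap_value_def by (simp only: count_split[of k])
qed

text \<open>The trivial bound by the degree: apply the arithmetic-geometric mean inequality to each
  translate, which preserves the norm.\<close>

lemma form_le_card:
  assumes S: "S \<subseteq> carrier G"
  shows "(\<Sum>x\<in>carrier G. f x * (\<Sum>t\<in>S. f (t \<otimes> x))) \<le> real (card S) * (\<Sum>x\<in>carrier G. f x * f x)"
proof -
  let ?q = "\<Sum>x\<in>carrier G. f x * f x"
  have "(\<Sum>x\<in>carrier G. f x * (\<Sum>t\<in>S. f (t \<otimes> x))) = (\<Sum>t\<in>S. \<Sum>x\<in>carrier G. f x * f (t \<otimes> x))"
    unfolding sum_distrib_left by (rule sum.swap)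
  also have "\<dots> \<le> (\<Sum>t\<in>S. ?q)"
  proof (rule sum_mono)
    fix t assume "t \<in> S"
    then have t: "t \<in> carrier G" using S by blast
    have "(\<Sum>x\<in>carrier G. f x * f (t \<otimes> x)) \<le> (\<Sum>x\<in>carrier G. (f x * f x + f (t \<otimes> x) * f (t \<otimes> x)) / 2)"
    proof (rule sum_mono)
      fix x
      show "f x * f (t \<otimes> x) \<le> (f x * f x + f (t \<otimes> x) * f (t \<otimes> x)) / 2"
        using zero_le_power2[of "f x - f (t \<otimes> x)"] by (simp add: power2_eq_square algebra_simps)
    qed
    also have "\<dots> = (?q + (\<Sum>x\<in>carrier G. f (t \<otimes> x) * f (t \<otimes> x))) / 2"
      by (simp add: sum.distrib sum_divide_distrib[symmetric])
    also have "\<dots> = ?q" using sum_mult_left[OF t, of "\<lambda>x. f x * f x"] by simp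
    finally show "(\<Sum>x\<in>carrier G. f x * f (t \<otimes> x)) \<le> ?q" .
  qed
  finally show ?thesis by simp
qed

text \<open>At level \<open>m\<close> the moved set is forced to be exactly \<open>{1..m}\<close>,
  so \<open>m + 1\<close> and \<open>m + 2\<close> are fixed. Thus the gap value is the degree, and
  \<open>form_le_card\<close> can start the descending induction.\<close>

lemma gap_value_top:
  assumes b: "b \<ge> 2"
  shows "gap_value n act T m = card (moves {1..m})"
proof -
  have n: "m + 2 \<le> n" using n_ge b by linarith
  have fixed: "act y t = y" if t: "t \<in> moves {1..m}" and y: "y \<in> {m+1, m+2}" for t y
  proof -
    have eq: "{1..m} = supp {1..n} act t"
    proof (rule card_seteq)
      show "{1..m} \<subseteq> supp {1..n} act t" "card (supp {1..n} act t) \<le> card {1..m}"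
        using t supp_le[of t] by (simp_all add: moving_def)
    qed (simp add: supp_def)
    have "y \<notin> supp {1..n} act t" unfolding eq[symmetric] using y by auto
    moreover have "y \<in> {1..n}" using y n by auto
    ultimately show ?thesis by (simp add: supp_def)
  qed
  have "{t \<in> moves {1..m}. act (m + 1) t = m + 1} = moves {1..m}" using fixed by auto
  moreover have "{t \<in> moves {1..m}. act (m + 2) t = m + 1} = {}" using fixed by force
  ultimately show ?thesis
    unfolding gap_value_def moving_count_def by (simp only: card.empty of_nat_0 diff_0_right)
qed

text \<open>The transporters from \<open>n\<close> are the right cosets of \<open>N\<close>, and
  left multiplication by \<open>S\<close> stays inside each. Orthogonality says that
  \<open>f\<close> sums to zero on every coset, so the bound on \<open>N\<close> applies coset by
  coset.\<close>

lemma stabilizer_form_bound: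
  assumes bound: "\<And>f. (\<Sum>x\<in>N. f x) = 0 \<Longrightarrow>
      (\<Sum>x\<in>N. f x * (\<Sum>t\<in>S. f (t \<otimes> x))) \<le> c * (\<Sum>x\<in>N. f x * f x)"
    and S: "S \<subseteq> N" and orth: "orthogonal_to_transporters f"
  shows "(\<Sum>x\<in>carrier G. f x * (\<Sum>t\<in>S. f (t \<otimes> x))) \<le> c * (\<Sum>x\<in>carrier G. f x * f x)"
proof -
  have "(\<Sum>x\<in>transporter G act n i. f x * (\<Sum>t\<in>S. f (t \<otimes> x)))
      \<le> c * (\<Sum>x\<in>transporter G act n i. f x * f x)" if i: "i \<in> {1..n}" for i
  proof -
    obtain h where h: "h \<in> carrier G" "act n h = i" using ex_act[OF n_mem i] by blast
    \<comment> \<open>Right multiplication by \<open>h\<close> identifies \<open>N\<close> with the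
      coset and commutes with left multiplication by elements of \<open>S\<close>.\<close>
    have re: "(\<Sum>x\<in>transporter G act n i. F x) = (\<Sum>y\<in>N. F (y \<otimes> h))" for F :: "'a \<Rightarrow> real"
    proof (rule sum.reindex_bij_witness[of _ "\<lambda>y. y \<otimes> h" "\<lambda>x. x \<otimes> inv h"])
      show "x \<otimes> inv h \<in> N" if "x \<in> transporter G act n i" for x
        using that h act_mult[OF n_mem, of x "inv h"] act_inv(1)[OF n_mem h(1)]
        by (simp add: transporter_def N_iff)
      show "y \<otimes> h \<in> transporter G act n i" if "y \<in> N" for y
        using that h act_mult[OF n_mem, of y h] by (simp add: transporter_def N_iff)
    qed (use h in \<open>auto simp: transporter_def N_iff m_assoc\<close>)
    have "(\<Sum>t\<in>S. f (t \<otimes> (y \<otimes> h))) = (\<Sum>t\<in>S. f ((t \<otimes> y) \<otimes> h))" if "y \<in> N" for y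
      by (intro sum.cong refl) (use that h S in \<open>auto simp: N_iff subset_iff m_assoc\<close>)
    moreover have "(\<Sum>y\<in>N. f (y \<otimes> h)) = 0"
      using orth i n_mem re[of f] by (simp add: orthogonal_to_transporters_def)
    ultimately show ?thesis
      unfolding re using bound[of "\<lambda>y. f (y \<otimes> h)"] by simp
  qed
  then have "(\<Sum>i\<in>{1..n}. \<Sum>x\<in>transporter G act n i. f x * (\<Sum>t\<in>S. f (t \<otimes> x)))
      \<le> (\<Sum>i\<in>{1..n}. c * (\<Sum>x\<in>transporter G act n i. f x * f x))"
    by (rule sum_mono)
  then show ?thesis
    unfolding sum_distrib_left[of c, symmetric] sum_over_transporters(2)[OF n_mem] .
qed

text \<open>Descending induction from \<open>k = m\<close>: the elements fixing \<open>n\<close> are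
  bounded through the stabilizer, those moving \<open>n\<close> through the induction hypothesis at
  \<open>Suc k\<close>, and the two constants add up by \<open>gap_value_split\<close>.\<close>

lemma orthogonal_form_bound:
  assumes b: "b \<ge> 2"
    and bound: "\<And>k f. k < m \<Longrightarrow> (\<Sum>x\<in>N. f x) = 0 \<Longrightarrow>
      (\<Sum>x\<in>N. f x * (\<Sum>t\<in>moving (n - 1) act (T \<inter> N) {1..k}. f (t \<otimes> x)))
        \<le> gap_value (n - 1) act (T \<inter> N) k * (\<Sum>x\<in>N. f x * f x)"
    and "k \<le> m" and "orthogonal_to_transporters f"
  shows "(\<Sum>x\<in>carrier G. f x * (\<Sum>t\<in>moves {1..k}. f (t \<otimes> x)))
      \<le> gap_value n act T k * (\<Sum>x\<in>carrier G. f x * f x)"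
  using assms(3,4)
proof (induction k arbitrary: f rule: inc_induct)
  case base
  have "moves {1..m} \<subseteq> carrier G" using moves_carrier by blast
  from form_le_card[OF this] show ?case by (simp add: gap_value_top[OF b])
next
  case (step k)
  have k: "k < m" "k < n" using step n_ge by linarith+
  let ?S = "moving (n - 1) act (T \<inter> N) {1..k}" and ?M = "moves (insert n {1..k})"
  have fS: "finite ?S" using finite_moves moves_split(1)[OF k(2)] by (metis finite_Un)
  have X: "insert n {1..k} \<subseteq> {1..n}" using n_mem k by auto
  have "card (insert n {1..k}) \<le> m + b"
    using k by (simp add: card_insert_if)
  moreover have "inj_on (\<lambda>x. if x = n then k + 1 else x) (insert n {1..k})"
    using k by (auto simp: inj_on_def)
  moreover have "(\<lambda>x. if x = n then k + 1 else x) ` insert n {1..k} \<subseteq> {1..n}"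
    using k by auto
  ultimately obtain g where g: "g \<in> carrier G"
    "\<forall>x\<in>insert n {1..k}. act x g = (if x = n then k + 1 else x)"
    using ex_map[OF X] by blast
  have "(\<lambda>x. act x g) ` insert n {1..k} = (\<lambda>x. if x = n then k + 1 else x) ` insert n {1..k}"
    by (intro image_cong refl) (use g in auto)
  also have "\<dots> = {1..Suc k}" using k by auto
  finally have bij: "bij_betw (\<lambda>t. inv g \<otimes> t \<otimes> g) ?M (moves {1..Suc k})"
    using moves_conj_bij[OF g(1) X] by simp
  \<comment> \<open>Translating \<open>f\<close> by \<open>g\<close> absorbs the conjugation: the
    sum of \<open>h\<close> over \<open>moves {1..Suc k}\<close> becomes a sum of \<open>f\<close>
    over \<open>?M\<close>. Translation permutes the transporters, so orthogonality is kept, and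
    sums over the group are unchanged.\<close>
  define h where "h y = f (g \<otimes> y)" for y
  have "orthogonal_to_transporters h"
    unfolding orthogonal_to_transporters_def
  proof (intro ballI)
    fix i j assume ij: "i \<in> {1..n}" "j \<in> {1..n}"
    have "act j (inv g) \<in> {1..n}" using ij g(1) act_closed by blast
    then show "(\<Sum>x\<in>transporter G act j i. h x) = 0"
      unfolding h_def sum_transporter[OF g(1) ij(2)]
      using step.prems ij by (simp add: orthogonal_to_transporters_def)
  qed
  from step.IH[OF this]
  have "(\<Sum>y\<in>carrier G. h y * (\<Sum>t\<in>moves {1..Suc k}. h (t \<otimes> y)))
      \<le> gap_value n act T (Suc k) * (\<Sum>y\<in>carrier G. h y * h y)" .
  moreover have "(\<Sum>t\<in>moves {1..Suc k}. h (t \<otimes> y)) = (\<Sum>t\<in>?M. f (t \<otimes> (g \<otimes> y)))"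
    if y: "y \<in> carrier G" for y
  proof -
    have "(\<Sum>t\<in>moves {1..Suc k}. h (t \<otimes> y)) = (\<Sum>t\<in>?M. h (inv g \<otimes> t \<otimes> g \<otimes> y))"
      by (rule sum.reindex_bij_betw[OF bij, symmetric])
    also have "\<dots> = (\<Sum>t\<in>?M. f (t \<otimes> (g \<otimes> y)))"
    proof (intro sum.cong refl)
      fix t assume "t \<in> ?M"
      then have t: "t \<in> carrier G" by (rule moves_carrier)
      have "g \<otimes> (inv g \<otimes> t \<otimes> g \<otimes> y) = t \<otimes> (g \<otimes> y)"
        using t g(1) y by (simp add: m_assoc[symmetric])
      then show "h (inv g \<otimes> t \<otimes> g \<otimes> y) = f (t \<otimes> (g \<otimes> y))" by (simp add: h_def)
    qed
    finally show ?thesis .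
  qed
  ultimately have "(\<Sum>y\<in>carrier G. f (g \<otimes> y) * (\<Sum>t\<in>?M. f (t \<otimes> (g \<otimes> y))))
      \<le> gap_value n act T (Suc k) * (\<Sum>y\<in>carrier G. f (g \<otimes> y) * f (g \<otimes> y))"
    by (simp add: h_def)
  then have M: "(\<Sum>x\<in>carrier G. f x * (\<Sum>t\<in>?M. f (t \<otimes> x)))
      \<le> gap_value n act T (Suc k) * (\<Sum>x\<in>carrier G. f x * f x)"
    using sum_mult_left[OF g(1), of "\<lambda>x. f x * (\<Sum>t\<in>?M. f (t \<otimes> x))"]
      sum_mult_left[OF g(1), of "\<lambda>x. f x * f x"] by simp
  have "?S \<subseteq> N" by (auto simp: moving_def)
  from stabilizer_form_bound[OF bound[OF k(1)] this step.prems]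
  have S: "(\<Sum>x\<in>carrier G. f x * (\<Sum>t\<in>?S. f (t \<otimes> x)))
      \<le> gap_value (n - 1) act (T \<inter> N) k * (\<Sum>x\<in>carrier G. f x * f x)" .
  have "(\<Sum>t\<in>moves {1..k}. F t) = (\<Sum>t\<in>?S. F t) + (\<Sum>t\<in>?M. F t)" for F :: "'a \<Rightarrow> real"
    using sum.union_disjoint[OF fS finite_moves moves_split(2)[OF k(2)], of F]
      moves_split(1)[OF k(2)] by simp
  then have "(\<Sum>x\<in>carrier G. f x * (\<Sum>t\<in>moves {1..k}. f (t \<otimes> x)))
      = (\<Sum>x\<in>carrier G. f x * (\<Sum>t\<in>?S. f (t \<otimes> x))) + (\<Sum>x\<in>carrier G. f x * (\<Sum>t\<in>?M. f (t \<otimes> x)))"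
    by (simp add: distrib_left sum.distrib)
  then show ?case
    using S M gap_value_split[OF k(1) b] by (simp add: distrib_right)
qed

lemma stabilizer_connection:
  assumes b: "b \<ge> 2"
  shows "transitive_connection (G\<lparr>carrier := N\<rparr>) (n - 1) act (T \<inter> N) m (b - 1)"
proof -
  interpret N: subgroup N G by (rule N_subgroup)
  have sub: "x \<in> {1..n}" if "x \<in> {1..n - 1}" for x using that by auto
  have closed: "act x g \<in> {1..n - 1}" if x: "x \<in> {1..n - 1}" and g: "g \<in> N" for x g
  proof -
    have "x \<noteq> n" using x n_mem by auto
    then have "act x g \<noteq> act n g"
      using act_eq_iff[OF sub[OF x] n_mem, of g] g by (simp add: N_iff)
    then have "act x g \<noteq> n" using g by (simp add: N_iff)
    moreover have "act x g \<in> {1..n}" using act_closed[OF sub[OF x]] g by (simp add: N_iff)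
    ultimately show ?thesis by auto
  qed
  have inv: "inv\<^bsub>G\<lparr>carrier := N\<rparr>\<^esub> g = inv g" if "g \<in> N" for g
    using that N_subgroup by (simp add: m_inv_consistent)
  have "group (G\<lparr>carrier := N\<rparr>)"
    using N_subgroup by (rule subgroup_imp_group)
  then show ?thesis
  proof (intro transitive_connection.intro right_action.intro right_action_axioms.intro
      transitive_connection_axioms.intro)
    show "finite (carrier (G\<lparr>carrier := N\<rparr>))"
      using fin N.subset finite_subset by auto
    show "act x g \<in> {1..n - 1}" if "x \<in> {1..n - 1}" "g \<in> carrier (G\<lparr>carrier := N\<rparr>)" for x g
      using closed that by simp
    show "act x \<one>\<^bsub>G\<lparr>carrier := N\<rparr>\<^esub> = x" if "x \<in> {1..n - 1}" for x
      using act_one[OF sub[OF that]] by simp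
    show "act x (g \<otimes>\<^bsub>G\<lparr>carrier := N\<rparr>\<^esub> h) = act (act x g) h"
      if "x \<in> {1..n - 1}" "g \<in> carrier (G\<lparr>carrier := N\<rparr>)" "h \<in> carrier (G\<lparr>carrier := N\<rparr>)" for x g h
      using act_mult[OF sub[OF that(1)]] that by (simp add: N_iff)
    show "T \<inter> N \<subseteq> carrier (G\<lparr>carrier := N\<rparr>)" by simp
    show "inv\<^bsub>G\<lparr>carrier := N\<rparr>\<^esub> t \<in> T \<inter> N" if "t \<in> T \<inter> N" for t
      using that inv T_inv by auto
    show "inv\<^bsub>G\<lparr>carrier := N\<rparr>\<^esub> g \<otimes>\<^bsub>G\<lparr>carrier := N\<rparr>\<^esub> t \<otimes>\<^bsub>G\<lparr>carrier := N\<rparr>\<^esub> g \<in> T \<inter> N"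
      if "g \<in> carrier (G\<lparr>carrier := N\<rparr>)" "t \<in> T \<inter> N" for g t
      using that inv T_conj[of g t] N.subset by auto
    show "card (supp {1..n - 1} act t) \<le> m" if "t \<in> T \<inter> N" for t
    proof -
      have "card (supp {1..n - 1} act t) \<le> card (supp {1..n} act t)"
        by (intro card_mono) (auto simp: supp_def)
      then show ?thesis using supp_le[of t] that by simp
    qed
    show "transitive_of_degree (G\<lparr>carrier := N\<rparr>) {1..n - 1} act (m + (b - 1))"
      unfolding transitive_of_degree_def
    proof (intro conjI allI impI)
      show "m + (b - 1) \<le> card {1..n - 1}" using n_ge b by simp
      fix xs ys
      assume A: "length xs = m + (b - 1) \<and> distinct xs \<and> set xs \<subseteq> {1..n - 1} \<and>
        length ys = m + (b - 1) \<and> distinct ys \<and> set ys \<subseteq> {1..n - 1}"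
      \<comment> \<open>Prepending \<open>n\<close> to both tuples forces the group element obtained
        from transitivity to fix \<open>n\<close>.\<close>
      have "length (n # xs) = m + b \<and> distinct (n # xs) \<and> set (n # xs) \<subseteq> {1..n} \<and>
        length (n # ys) = m + b \<and> distinct (n # ys) \<and> set (n # ys) \<subseteq> {1..n}"
      proof -
        have "n \<notin> {1..n - 1}" "{1..n - 1} \<subseteq> {1..n}" using n_mem by auto
        then have "n \<notin> set xs" "n \<notin> set ys" "set xs \<subseteq> {1..n}" "set ys \<subseteq> {1..n}" using A by blast+
        then show ?thesis using A n_mem b by simp
      qed
      from conjunct2[OF trans[unfolded transitive_of_degree_def], rule_format, OF this]
      show "\<exists>g\<in>carrier (G\<lparr>carrier := N\<rparr>). map (\<lambda>x. act x g) xs = ys"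
        by (auto simp: N_iff)
    qed
    show "m \<ge> 1" by (rule m_pos)
    show "b - 1 \<ge> 1" using b by simp
  qed
qed

text \<open>The equality in the stabilizer turns its variational bound into one with the explicit
  gap value, as \<open>orthogonal_form_bound\<close> requires. The reverse inequality comes from
  lifting eigenvectors of the quotient matrix.\<close>

lemma lambda2_step:
  assumes b: "b \<ge> 2"
    and stab: "\<And>k. k < m \<Longrightarrow>
      graph_lambda2 (Cay (G\<lparr>carrier := N\<rparr>) (moving (n - 1) act (T \<inter> N) {1..k}))
        = mat_lambda2 (B_Pi (G\<lparr>carrier := N\<rparr>) (n - 1) act (T \<inter> N) k 0)"
    and k: "k < m"
  shows "graph_lambda2 (Cay G (moves {1..k})) = mat_lambda2 (B_Pi G n act T k 0)"
proof -
  interpret S: transitive_connection "G\<lparr>carrier := N\<rparr>" "n - 1" act "T \<inter> N" m "b - 1"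
    by (rule stabilizer_connection[OF b])
  have bound: "(\<Sum>x\<in>N. f x * (\<Sum>t\<in>moving (n - 1) act (T \<inter> N) {1..j}. f (t \<otimes> x)))
      \<le> gap_value (n - 1) act (T \<inter> N) j * (\<Sum>x\<in>N. f x * f x)"
    if j: "j < m" and f: "(\<Sum>x\<in>N. f x) = 0" for j f
  proof -
    have "moving (n - 1) act (T \<inter> N) {1..j} \<subseteq> carrier (G\<lparr>carrier := N\<rparr>)"
      using S.moves_carrier by blast
    from S.graph_lambda2_variational(1)[OF this, of f] show ?thesis
      using f stab[OF j] S.B_Pi_lambda2[OF j] by simp
  qed
  have "graph_lambda2 (Cay G (moves {1..k})) \<le> gap_value n act T k"
    by (rule graph_lambda2_le_gap[OF k], rule orthogonal_form_bound[OF b bound]) (use k in auto)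
  then show ?thesis using gap_le_graph_lambda2[OF k] B_Pi_lambda2[OF k] by simp
qed

section \<open>Iterating along the chain of pointwise stabilizers\<close>

lemma tail_stabilizer_N:
  assumes "i + 1 \<le> n"
  shows "tail_stabilizer (G\<lparr>carrier := N\<rparr>) (n - 1) act i = tail_stabilizer G n act (i + 1)"
proof -
  have eq: "{n - (i + 1) + 1..n} = insert n {n - 1 - i + 1..n - 1}" using assms by auto
  show ?thesis
    unfolding tail_stabilizer_def pointwise_stabilizer_def eq by (auto simp: N_iff)
qed

lemma T_sub_N:
  assumes "k < n" "i + 1 \<le> n"
  shows "T_sub (n - 1) act (T \<inter> N) k \<inter> tail_stabilizer G n act (i + 1)
       = T_sub n act T k \<inter> tail_stabilizer G n act (i + 1)"
proof -
  have "tail_stabilizer G n act (i + 1) \<subseteq> N"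
    using assms by (auto simp: tail_stabilizer_def pointwise_stabilizer_def N_iff)
  then show ?thesis
    unfolding T_sub_eq_moving moving_N[OF assms(1)] by (auto simp: N_iff)
qed

lemma Cay_sub_N:
  assumes "k < n" "i + 1 \<le> n"
  shows "Cay_sub (G\<lparr>carrier := N\<rparr>) (n - 1) act (T \<inter> N) k i = Cay_sub G n act T k (i + 1)"
  using T_sub_N[OF assms] tail_stabilizer_N[OF assms(2)] by (simp add: Cay_sub_def)

lemma B_Pi_N:
  assumes "k < n" "i + 1 \<le> n"
  shows "B_Pi (G\<lparr>carrier := N\<rparr>) (n - 1) act (T \<inter> N) k i = B_Pi G n act T k (i + 1)"
proof -
  have "tail_stabilizer G n act (i + 1) \<subseteq> N"
    using assms by (auto simp: tail_stabilizer_def pointwise_stabilizer_def N_iff)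
  then have "A \<inter> tail_stabilizer G n act (i + 1) \<inter> transporter (G\<lparr>carrier := N\<rparr>) act y z
      = A \<inter> tail_stabilizer G n act (i + 1) \<inter> transporter G act y z" for A y z
    by (auto simp: transporter_def N_iff)
  moreover have "n - 1 - i = n - (i + 1)" by simp
  ultimately show ?thesis
    unfolding B_Pi_def tail_stabilizer_N[OF assms(2)] T_sub_N[OF assms] by simp
qed

lemma Cay_sub_0: "Cay_sub G n act T k 0 = Cay G (moves {1..k})"
proof -
  have "tail_stabilizer G n act 0 = carrier G"
    by (simp add: tail_stabilizer_def pointwise_stabilizer_def)
  moreover have "moves {1..k} \<inter> carrier G = moves {1..k}" using moves_carrier by blast
  ultimately show ?thesis by (simp add: Cay_sub_def T_sub_eq_moving)
qed

end

text \<open>Induction on \<open>a\<close> with the group, \<open>n\<close> and \<open>T\<close>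
  arbitrary: the induction hypothesis is applied to the stabilizer of \<open>n\<close>, and
  \<open>lambda2_step\<close> then climbs from there to the group itself.\<close>

lemma lambda2_descend:
  assumes "transitive_connection G n act T m a"
    and "\<And>k. k < m \<Longrightarrow> graph_lambda2 (Cay_sub G n act T k (a - 1)) = mat_lambda2 (B_Pi G n act T k (a - 1))"
    and "k < m"
  shows "graph_lambda2 (Cay_sub G n act T k 0) = mat_lambda2 (B_Pi G n act T k 0)"
  using assms
proof (induction a arbitrary: G n T k)
  case 0
  then show ?case by (simp add: transitive_connection_def transitive_connection_axioms_def)
next
  case (Suc a)
  interpret transitive_connection G n act T m "Suc a" by (rule Suc.prems(1))
  show ?case
  proof (cases "a = 0")
    case True
    then show ?thesis using Suc.prems(2)[OF Suc.prems(3)] by simp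
  next
    case False
    then have b: "Suc a \<ge> 2" by simp
    let ?H = "G\<lparr>carrier := N\<rparr>"
    have S: "transitive_connection ?H (n - 1) act (T \<inter> N) m a"
      using stabilizer_connection[OF b] by simp
    interpret S: transitive_connection ?H "n - 1" act "T \<inter> N" m a by (rule S)
    \<comment> \<open>Level \<open>a - 1\<close> inside the stabilizer is level \<open>a\<close> in
      the group, where the assumption is available.\<close>
    have "graph_lambda2 (Cay_sub ?H (n - 1) act (T \<inter> N) j (a - 1))
        = mat_lambda2 (B_Pi ?H (n - 1) act (T \<inter> N) j (a - 1))" if "j < m" for j
      using Cay_sub_N[of j "a - 1"] B_Pi_N[of j "a - 1"] Suc.prems(2)[OF that] that n_ge False by simp
    from Suc.IH[OF S this]
    have "graph_lambda2 (Cay ?H (moving (n - 1) act (T \<inter> N) {1..j}))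
        = mat_lambda2 (B_Pi ?H (n - 1) act (T \<inter> N) j 0)" if "j < m" for j
      using that S.Cay_sub_0 by simp
    from lambda2_step[OF b this Suc.prems(3)] show ?thesis by (simp add: Cay_sub_0)
  qed
qed

theorem theorem3p5:
  fixes \<Gamma> :: "('g, 'b) monoid_scheme" and n m a :: nat
    and act :: "nat \<Rightarrow> 'g \<Rightarrow> nat" and T :: "'g set"
  assumes "group \<Gamma>" and "finite (carrier \<Gamma>)"
    and "right_action \<Gamma> {1..n} act"
    and "connected_normal_connection_set \<Gamma> T"
    and "m = Max ((\<lambda>\<tau>. card (supp {1..n} act \<tau>)) ` T)"
    and "a \<ge> 1"
    and "transitive_of_degree \<Gamma> {1..n} act (m + a)"
    and "\<forall>k<m. graph_lambda2 (Cay_sub \<Gamma> n act T k (a - 1)) = mat_lambda2 (B_Pi \<Gamma> n act T k (a - 1))"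
  shows "(\<forall>k<m.
            graph_lambda2 (Cay \<Gamma> (T_sub n act T k)) = mat_lambda2 (B_Pi \<Gamma> n act T k 0) \<and>
            mat_lambda2 (B_Pi \<Gamma> n act T k 0) =
              real (card (T_sub n act T k \<inter> point_stabilizer \<Gamma> act (k + 1)))
              - real (card (T_sub n act T k \<inter> transporter \<Gamma> act (k + 2) (k + 1)))) \<and>
         (0 < m \<longrightarrow>
            graph_lambda2 (Cay \<Gamma> T) = mat_lambda2 (B_Pi \<Gamma> n act T 0 0) \<and>
            mat_lambda2 (B_Pi \<Gamma> n act T 0 0) =
              real (card (T \<inter> point_stabilizer \<Gamma> act 1)) - real (card (T \<inter> transporter \<Gamma> act 2 1)))"
proof (cases "m = 0")
  \<comment> \<open>For \<open>m = 0\<close> both conjuncts are vacuous; otherwise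
    \<open>m \<ge> 1\<close>, as the locale demands.\<close>
  case False
  have T: "T \<subseteq> carrier \<Gamma>" "set_inv\<^bsub>\<Gamma>\<^esub> T = T"
    "\<And>g t. g \<in> carrier \<Gamma> \<Longrightarrow> t \<in> T \<Longrightarrow> g \<otimes>\<^bsub>\<Gamma>\<^esub> t \<otimes>\<^bsub>\<Gamma>\<^esub> inv\<^bsub>\<Gamma>\<^esub> g \<in> T"
    using assms(4) by (auto simp: connected_normal_connection_set_def)
  interpret group \<Gamma> by (rule assms(1))
  interpret transitive_connection \<Gamma> n act T m a
  proof (intro transitive_connection.intro transitive_connection_axioms.intro)
    show "inv\<^bsub>\<Gamma>\<^esub> t \<in> T" if "t \<in> T" for t using that T(2) by (auto simp: SET_INV_def)
    show "inv\<^bsub>\<Gamma>\<^esub> g \<otimes>\<^bsub>\<Gamma>\<^esub> t \<otimes>\<^bsub>\<Gamma>\<^esub> g \<in> T" if "g \<in> carrier \<Gamma>" "t \<in> T" for g t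
      using T(3)[of "inv\<^bsub>\<Gamma>\<^esub> g" t] that by simp
    \<comment> \<open>For empty \<open>T\<close> the value of \<open>Max\<close> is unspecified, but
      then there is no support to bound.\<close>
    have "finite T" using T(1) assms(2) finite_subset by blast
    then show "card (supp {1..n} act t) \<le> m" if "t \<in> T" for t
      unfolding assms(5) using that by (intro Max_ge) auto
  qed (use assms T(1) False in auto)
  have main: "graph_lambda2 (Cay \<Gamma> (T_sub n act T k)) = mat_lambda2 (B_Pi \<Gamma> n act T k 0) \<and>
      mat_lambda2 (B_Pi \<Gamma> n act T k 0) =
        real (card (T_sub n act T k \<inter> point_stabilizer \<Gamma> act (k + 1)))
        - real (card (T_sub n act T k \<inter> transporter \<Gamma> act (k + 2) (k + 1)))" if k: "k < m" for k
  proof -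
    have "moves {1..k} \<inter> transporter \<Gamma> act y z = {t \<in> moves {1..k}. act y t = z}" for y z
      using moves_carrier by (auto simp: transporter_def)
    then have "gap_value n act T k = real (card (T_sub n act T k \<inter> point_stabilizer \<Gamma> act (k + 1)))
        - real (card (T_sub n act T k \<inter> transporter \<Gamma> act (k + 2) (k + 1)))"
      by (simp add: gap_value_def moving_count_def T_sub_eq_moving point_stabilizer_def)
    moreover have "graph_lambda2 (Cay_sub \<Gamma> n act T k 0) = mat_lambda2 (B_Pi \<Gamma> n act T k 0)"
      by (rule lambda2_descend[OF transitive_connection_axioms _ k]) (use assms(8) in blast)
    ultimately show ?thesis using B_Pi_lambda2[OF k] by (simp add: Cay_sub_0 T_sub_eq_moving)
  qed
  moreover have "T_sub n act T 0 = T" by (simp add: T_sub_def)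
  ultimately show ?thesis using main[of 0] by (simp add: numeral_2_eq_2)
qed simp

end
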